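(* Let $(\mathbb{H},\mu,\eta,\Delta,\epsilon,S)$ be a weak Hopf algebra over $\bm k$ with bijective antipode $S$. Let $A=\Pi^L(\mathbb{H})$, let $\alpha\colon A\hookrightarrow\mathbb{H}$ be the inclusion, $\beta=\bar\Pi^L|_A$, $\pi\colon\mathbb{H}\otimes_{\bm k}\mathbb{H}\to\mathbb{H}\otimes_A\mathbb{H}$ the projection, $\Delta'=\pi\circ\Delta$, and $\mathcal{B}=\Delta(1)(\mathbb{H}\otimes\mathbb{H})\Delta(1)$. Then $(\mathbb{H},\mu,\alpha,\beta,\Delta',\Pi^L)$ with balancing subalgebra $\mathcal{B}$ and antipode $\tau=S$ is a Hopf $A$-algebroid with balancing subalgebra $\mathcal{B}$.
   Context: Let $\bm k$ be a field, $\otimes=\otimes_{\bm k}$. **Weak Hopf algebra.** A weak $\bm k$-bialgebra $(\mathbb{H},\mu,\eta,\Delta,\epsilon)$ is an associative unital algebra $(\mathbb H,\mu,\eta)$ and a coassociative counital coalgebra $(\mathbb H,\Delta,\epsilon)$ such that: $\Delta(ab)=\Delta(a)\Delta(b)$; $\epsilon(xyz)=\epsilon(xy_{(1)})\epsilon(y_{(2)}z)=\epsilon(xy_{(2)})\epsilon(y_{(1)}z)$ for all $x,y,z$; and $(\Delta\otimes\mathrm{id})\Delta(1)=(\Delta(1)\otimes1)(1\otimes\Delta(1))=(1\otimes\Delta(1))(\Delta(1)\otimes1)$. Write $\Delta(1)=1_{(1)}\otimes1_{(2)}$ and define $\Pi^L(x)=\epsilon(1_{(1)}x)1_{(2)}$,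 $\bar\Pi^L(x)=\epsilon(1_{(2)}x)1_{(1)}$. It is a weak Hopf algebra if there is a linear map $S\colon\mathbb{H}\to\mathbb{H}$ (antipode) with $x_{(1)}S(x_{(2)})=\epsilon(1_{(1)}x)1_{(2)}$, $S(x_{(1)})x_{(2)}=1_{(1)}\epsilon(x1_{(2)})$, $S(x_{(1)})x_{(2)}S(x_{(3)})=S(x)$ for all $x$. **Bialgebroid with balancing subalgebra.** For a unital algebra $A$: an $A\otimes A^{\mathrm{op}}$-ring $(H,\mu,\alpha,\beta)$ is a unital algebra with unital algebra homomorphisms $\alpha\colon A\to H$, $\beta\colon A^{\mathrm{op}}\to H$ with commuting images. An $A$-coring is an $A$-bimodule $H$ with a coassociative bimodule map $\Delta'\colon H\to H\otimes_AH$ and a bimodule map counit $\epsilon'\colon H\to A$. Let $\pi\colon H\otimes H\to H\otimes_AH$ be the projection and $I_A=\operatorname{Ker}\pi$, the right ideal generated by all $\beta(a)\otimes1-1\otimes\alpha(a)$. A left $A$-bialgebroid with balancing subalgebra $\mathcal{B}$ consists of such a ring and coring and a (not necessarily unital) subalgebra $\mathcal{B}\subset H\otimes H$ with: (C1) the bimodule structure is $a.h.b=\alpha(a)\beta(b)h$; (C2) $h\triangleright a:=\epsilon'(h\alpha(a))$ is an action of $H$ on $A$; (C3MI) $I_A\cap\mathcal{B}$ is a two-sided ideal in $\mathcal{B}$; (C3Ma) $\mathrm{Im}\,\Delta'\subset\mathcal{B}/(I_A\cap\mathcal{B})$ (identified with $\pi(\mathcal{B})\subset H\otimes_AH$); (C3Mb)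 $\Delta'\colon H\to\mathcal{B}/(I_A\cap\mathcal{B})$ is a homomorphism of algebras (multiplicative, with $\Delta'(1)=1\otimes_A1$). **Hopf $A$-algebroid with balancing subalgebra $\mathcal{B}$.** Such a bialgebroid with an algebra antihomomorphism $\tau\colon H\to H$ such that $\mu(\mathrm{id}\otimes_{\bm k}\tau)(I_A\cap\mathcal{B})=0$; $\tau\beta=\alpha$; $\mu(\mathrm{id}\otimes_A\tau)\Delta'=\alpha\epsilon'$ (left side computed on any representative of $\Delta'(h)$ in $\mathcal{B}$); $\mu(\tau\otimes_A\mathrm{id})\Delta'=\beta\epsilon'\tau$. *)

theory Defs
  imports Complex_Main "HOL-Library.Multiset"
begin

section \<open>Algebras\<close>

text \<open>The sort \<open>{ring, monoid_mult}\<close> is that of associative unital rings in which \<open>0 = 1\<close> is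
  allowed, so the zero algebra is included.\<close>

locale k_algebra = vector_space scale
  for scale :: "'k::field \<Rightarrow> 'h::{ring,monoid_mult} \<Rightarrow> 'h" +
  assumes scale_mult_left: "scale c x * y = scale c (x * y)"
    and scale_mult_right: "x * scale c y = scale c (x * y)"

locale unital_subalgebra = k_algebra scale
  for scale :: "'k::field \<Rightarrow> 'a::{ring,monoid_mult} \<Rightarrow> 'a" +
  fixes A :: "'a set"
  assumes subspace_A: "module.subspace scale A"
    and one_A: "1 \<in> A"
    and mult_A: "a \<in> A \<Longrightarrow> b \<in> A \<Longrightarrow> a * b \<in> A"


section \<open>Tensor products\<close>

text \<open>A finite multiset of pairs \<open>{#(x1, y1), \<dots>, (xn, yn)#}\<close> is read as the formal sum of the
  elementary tensors \<open>xi \<otimes> yi\<close>. The tensor product is the quotient of the monoid of formal sums by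
  the congruence generated by biadditivity and the balancing relation. No formal negatives are
  needed: the relations identify \<open>0 \<otimes> y\<close> and \<open>x \<otimes> 0\<close> with the empty sum, so that \<open>(- x) \<otimes> y\<close> is
  inverse to \<open>x \<otimes> y\<close>, and the quotient is the usual abelian group.\<close>

inductive_set congruence_closure ::
    "('g multiset \<times> 'g multiset) set \<Rightarrow> ('g multiset \<times> 'g multiset) set"
  for R where
  base: "(s, t) \<in> R \<Longrightarrow> (s, t) \<in> congruence_closure R"
| refl: "(s, s) \<in> congruence_closure R"
| sym: "(s, t) \<in> congruence_closure R \<Longrightarrow> (t, s) \<in> congruence_closure R"
| trans: "(s, t) \<in> congruence_closure R \<Longrightarrow> (t, u) \<in> congruence_closure R
    \<Longrightarrow> (s, u) \<in> congruence_closure R"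
| add: "(s, t) \<in> congruence_closure R \<Longrightarrow> (s + u, t + u) \<in> congruence_closure R"

text \<open>\<open>R\<close> is the set of scalars, acting by \<open>ract\<close> on the right of the left factor and by \<open>lact\<close> on
  the left of the right factor.\<close>

definition tensor_relators ::
    "'r set \<Rightarrow> ('h \<Rightarrow> 'r \<Rightarrow> 'h) \<Rightarrow> ('r \<Rightarrow> 'h \<Rightarrow> 'h::ab_group_add)
      \<Rightarrow> (('h \<times> 'h) multiset \<times> ('h \<times> 'h) multiset) set" where
  "tensor_relators R ract lact =
      {({#(x + x', y)#}, {#(x, y), (x', y)#}) | x x' y. True}
    \<union> {({#(x, y + y')#}, {#(x, y), (x, y')#}) | x y y'. True}
    \<union> {({#(0, y)#}, {#}) | y. True}
    \<union> {({#(x, 0)#}, {#}) | x. True}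
    \<union> {({#(ract x r, y)#}, {#(x, lact r y)#}) | x r y. r \<in> R}"

definition tensor_eq ::
    "'r set \<Rightarrow> ('h \<Rightarrow> 'r \<Rightarrow> 'h) \<Rightarrow> ('r \<Rightarrow> 'h \<Rightarrow> 'h::ab_group_add)
      \<Rightarrow> (('h \<times> 'h) multiset \<times> ('h \<times> 'h) multiset) set" where
  "tensor_eq R ract lact = congruence_closure (tensor_relators R ract lact)"

text \<open>Threefold tensor products, free of bracketing: the relations are those of the twofold product
  in two adjacent factors.\<close>

definition tensor3_eq ::
    "'r set \<Rightarrow> ('h \<Rightarrow> 'r \<Rightarrow> 'h) \<Rightarrow> ('r \<Rightarrow> 'h \<Rightarrow> 'h::ab_group_add)
      \<Rightarrow> (('h \<times> 'h \<times> 'h) multiset \<times> ('h \<times> 'h \<times> 'h) multiset) set" where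
  "tensor3_eq R ract lact = congruence_closure
     ({(image_mset (\<lambda>(x, y). (x, y, z)) s, image_mset (\<lambda>(x, y). (x, y, z)) t) | s t z.
         (s, t) \<in> tensor_relators R ract lact}
    \<union> {(image_mset (\<lambda>(y, z). (x, y, z)) s, image_mset (\<lambda>(y, z). (x, y, z)) t) | s t x.
         (s, t) \<in> tensor_relators R ract lact})"

abbreviation tensor_space :: "('g multiset \<times> 'g multiset) set \<Rightarrow> 'g multiset set set" where
  "tensor_space E \<equiv> UNIV // E"

definition tensor_class ::
    "('g multiset \<times> 'g multiset) set \<Rightarrow> 'g multiset \<Rightarrow> 'g multiset set" where
  "tensor_class E t = E `` {t}"

text \<open>Operations on tensors induced by operations on formal sums. Each union is over representatives
  and is a single class whenever the operation respects the congruences.\<close>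

definition tensor_map ::
    "('g' multiset \<times> 'g' multiset) set \<Rightarrow> ('g multiset \<Rightarrow> 'g' multiset)
      \<Rightarrow> 'g multiset set \<Rightarrow> 'g' multiset set" where
  "tensor_map E' F X = (\<Union>t\<in>X. tensor_class E' (F t))"

definition tensor_plus ::
    "('g multiset \<times> 'g multiset) set \<Rightarrow> 'g multiset set \<Rightarrow> 'g multiset set \<Rightarrow> 'g multiset set" where
  "tensor_plus E X Y = (\<Union>s\<in>X. \<Union>t\<in>Y. tensor_class E (s + t))"

definition tensor_times ::
    "('g multiset \<times> 'g multiset) set \<Rightarrow> ('g \<Rightarrow> 'g \<Rightarrow> 'g)
      \<Rightarrow> 'g multiset set \<Rightarrow> 'g multiset set \<Rightarrow> 'g multiset set" where
  "tensor_times E op X Y = (\<Union>s\<in>X. \<Union>t\<in>Y. tensor_class E (\<Sum>u\<in>#s. image_mset (op u) t))"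

definition tensor_scale ::
    "(('h \<times> 'h) multiset \<times> ('h \<times> 'h) multiset) set \<Rightarrow> ('k \<Rightarrow> 'h \<Rightarrow> 'h)
      \<Rightarrow> 'k \<Rightarrow> ('h \<times> 'h) multiset set \<Rightarrow> ('h \<times> 'h) multiset set" where
  "tensor_scale E scale c = tensor_map E (image_mset (\<lambda>(x, y). (scale c x, y)))"

fun times2 :: "'h::times \<times> 'h \<Rightarrow> 'h \<times> 'h \<Rightarrow> 'h \<times> 'h" where
  "times2 (x, y) (x', y') = (x * x', y * y')"

fun times3 :: "'h::times \<times> 'h \<times> 'h \<Rightarrow> 'h \<times> 'h \<times> 'h \<Rightarrow> 'h \<times> 'h \<times> 'h" where
  "times3 (x, y, z) (x', y', z') = (x * x', y * y', z * z')"

text \<open>The map out of a tensor product induced by a balanced multiadditive map \<open>\<phi>\<close>; it interprets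
  expressions in Sweedler notation.\<close>

definition tensor_lift :: "('g \<Rightarrow> 'c::comm_monoid_add) \<Rightarrow> 'g multiset set \<Rightarrow> 'c" where
  "tensor_lift \<phi> X = the_elem ((\<lambda>t. \<Sum>w\<in>#t. \<phi> w) ` X)"

definition tensor_linear ::
    "(('h \<times> 'h) multiset \<times> ('h \<times> 'h) multiset) set \<Rightarrow> ('k \<Rightarrow> 'h \<Rightarrow> 'h::ab_group_add)
      \<Rightarrow> ('h \<Rightarrow> ('h \<times> 'h) multiset set) \<Rightarrow> bool" where
  "tensor_linear E scale \<Delta> \<longleftrightarrow>
     (\<forall>x. \<Delta> x \<in> tensor_space E) \<and>
     (\<forall>x y. \<Delta> (x + y) = tensor_plus E (\<Delta> x) (\<Delta> y)) \<and>
     (\<forall>c x. \<Delta> (scale c x) = tensor_scale E scale c (\<Delta> x))"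

text \<open>\<open>\<Delta> \<otimes> id\<close> and \<open>id \<otimes> \<Delta>\<close>, from the twofold to the threefold tensor product; \<open>d\<close> chooses
  representatives of the values of \<open>\<Delta>\<close>.\<close>

definition comult_left ::
    "(('h \<times> 'h \<times> 'h) multiset \<times> ('h \<times> 'h \<times> 'h) multiset) set \<Rightarrow> ('h \<Rightarrow> ('h \<times> 'h) multiset set)
      \<Rightarrow> ('h \<times> 'h) multiset set \<Rightarrow> ('h \<times> 'h \<times> 'h) multiset set" where
  "comult_left E3 \<Delta> X = (\<Union>t\<in>X. \<Union>d\<in>{d. \<forall>x. d x \<in> \<Delta> x}.
     tensor_class E3 (\<Sum>(x, y)\<in>#t. image_mset (\<lambda>(u, v). (u, v, y)) (d x)))"

definition comult_right ::
    "(('h \<times> 'h \<times> 'h) multiset \<times> ('h \<times> 'h \<times> 'h) multiset) set \<Rightarrow> ('h \<Rightarrow> ('h \<times> 'h) multiset set)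
      \<Rightarrow> ('h \<times> 'h) multiset set \<Rightarrow> ('h \<times> 'h \<times> 'h) multiset set" where
  "comult_right E3 \<Delta> X = (\<Union>t\<in>X. \<Union>d\<in>{d. \<forall>x. d x \<in> \<Delta> x}.
     tensor_class E3 (\<Sum>(x, y)\<in>#t. image_mset (\<lambda>(u, v). (x, u, v)) (d y)))"


section \<open>Weak Hopf algebras\<close>

abbreviation k_tensor_eq ::
    "('k \<Rightarrow> 'h \<Rightarrow> 'h::ab_group_add) \<Rightarrow> (('h \<times> 'h) multiset \<times> ('h \<times> 'h) multiset) set" where
  "k_tensor_eq scale \<equiv> tensor_eq UNIV (\<lambda>x c. scale c x) scale"

abbreviation k_tensor3_eq ::
    "('k \<Rightarrow> 'h \<Rightarrow> 'h::ab_group_add)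
      \<Rightarrow> (('h \<times> 'h \<times> 'h) multiset \<times> ('h \<times> 'h \<times> 'h) multiset) set" where
  "k_tensor3_eq scale \<equiv> tensor3_eq UNIV (\<lambda>x c. scale c x) scale"

abbreviation k_tensor_times ::
    "('k \<Rightarrow> 'h \<Rightarrow> 'h::ring) \<Rightarrow> ('h \<times> 'h) multiset set \<Rightarrow> ('h \<times> 'h) multiset set
      \<Rightarrow> ('h \<times> 'h) multiset set" where
  "k_tensor_times scale \<equiv> tensor_times (k_tensor_eq scale) times2"

abbreviation k_tensor3_times ::
    "('k \<Rightarrow> 'h \<Rightarrow> 'h::ring) \<Rightarrow> ('h \<times> 'h \<times> 'h) multiset set \<Rightarrow> ('h \<times> 'h \<times> 'h) multiset set
      \<Rightarrow> ('h \<times> 'h \<times> 'h) multiset set" where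
  "k_tensor3_times scale \<equiv> tensor_times (k_tensor3_eq scale) times3"

locale weak_bialgebra = k_algebra scale
  for scale :: "'k::field \<Rightarrow> 'h::{ring,monoid_mult} \<Rightarrow> 'h" +
  fixes \<Delta> :: "'h \<Rightarrow> ('h \<times> 'h) multiset set"
    and \<epsilon> :: "'h \<Rightarrow> 'k"
  assumes comult_linear: "tensor_linear (k_tensor_eq scale) scale \<Delta>"
    and counit_linear: "Vector_Spaces.linear scale (*) \<epsilon>"
    and coassoc: "comult_left (k_tensor3_eq scale) \<Delta> (\<Delta> x)
      = comult_right (k_tensor3_eq scale) \<Delta> (\<Delta> x)"
    and counit_left: "tensor_lift (\<lambda>(x1, x2). scale (\<epsilon> x1) x2) (\<Delta> x) = x"
    and counit_right: "tensor_lift (\<lambda>(x1, x2). scale (\<epsilon> x2) x1) (\<Delta> x) = x"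
    and comult_mult: "\<Delta> (x * y) = k_tensor_times scale (\<Delta> x) (\<Delta> y)"
    and counit_mult: "\<epsilon> (x * y * z) = tensor_lift (\<lambda>(y1, y2). \<epsilon> (x * y1) * \<epsilon> (y2 * z)) (\<Delta> y)"
    and counit_mult': "\<epsilon> (x * y * z) = tensor_lift (\<lambda>(y1, y2). \<epsilon> (x * y2) * \<epsilon> (y1 * z)) (\<Delta> y)"
    and comult_one: "comult_left (k_tensor3_eq scale) \<Delta> (\<Delta> 1)
      = k_tensor3_times scale
          (tensor_map (k_tensor3_eq scale) (image_mset (\<lambda>(x, y). (x, y, 1))) (\<Delta> 1))
          (tensor_map (k_tensor3_eq scale) (image_mset (\<lambda>(x, y). (1, x, y))) (\<Delta> 1))"
    and comult_one': "comult_left (k_tensor3_eq scale) \<Delta> (\<Delta> 1)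
      = k_tensor3_times scale
          (tensor_map (k_tensor3_eq scale) (image_mset (\<lambda>(x, y). (1, x, y))) (\<Delta> 1))
          (tensor_map (k_tensor3_eq scale) (image_mset (\<lambda>(x, y). (x, y, 1))) (\<Delta> 1))"

definition Pi_L ::
    "('k::field \<Rightarrow> 'h::{ring,monoid_mult} \<Rightarrow> 'h) \<Rightarrow> ('h \<Rightarrow> ('h \<times> 'h) multiset set) \<Rightarrow> ('h \<Rightarrow> 'k)
      \<Rightarrow> 'h \<Rightarrow> 'h" where
  "Pi_L scale \<Delta> \<epsilon> x = tensor_lift (\<lambda>(e1, e2). scale (\<epsilon> (e1 * x)) e2) (\<Delta> 1)"

definition Pi_L_bar ::
    "('k::field \<Rightarrow> 'h::{ring,monoid_mult} \<Rightarrow> 'h) \<Rightarrow> ('h \<Rightarrow> ('h \<times> 'h) multiset set) \<Rightarrow> ('h \<Rightarrow> 'k)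
      \<Rightarrow> 'h \<Rightarrow> 'h" where
  "Pi_L_bar scale \<Delta> \<epsilon> x = tensor_lift (\<lambda>(e1, e2). scale (\<epsilon> (e2 * x)) e1) (\<Delta> 1)"

locale weak_hopf_algebra = weak_bialgebra scale \<Delta> \<epsilon>
  for scale :: "'k::field \<Rightarrow> 'h::{ring,monoid_mult} \<Rightarrow> 'h"
    and \<Delta> :: "'h \<Rightarrow> ('h \<times> 'h) multiset set"
    and \<epsilon> :: "'h \<Rightarrow> 'k" +
  fixes S :: "'h \<Rightarrow> 'h"
  assumes antipode_linear: "Vector_Spaces.linear scale scale S"
    and antipode_right: "tensor_lift (\<lambda>(x1, x2). x1 * S x2) (\<Delta> x)
      = tensor_lift (\<lambda>(e1, e2). scale (\<epsilon> (e1 * x)) e2) (\<Delta> 1)"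
    and antipode_left: "tensor_lift (\<lambda>(x1, x2). S x1 * x2) (\<Delta> x)
      = tensor_lift (\<lambda>(e1, e2). scale (\<epsilon> (x * e2)) e1) (\<Delta> 1)"
    and antipode_both: "tensor_lift (\<lambda>(x1, x2, x3). S x1 * x2 * S x3)
      (comult_left (k_tensor3_eq scale) \<Delta> (\<Delta> x)) = S x"


section \<open>Bialgebroids and Hopf algebroids with balancing subalgebra\<close>

text \<open>An arbitrary unital base algebra is given as a unital subalgebra \<open>A\<close> of an algebra on a type
  \<open>'a\<close> (possibly all of it); all maps out of the base are only constrained on \<open>A\<close>.\<close>

locale source_target =
  base: unital_subalgebra scaleA A + total: k_algebra scale
  for scaleA :: "'k::field \<Rightarrow> 'a::{ring,monoid_mult} \<Rightarrow> 'a" and A :: "'a set"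
    and scale :: "'k \<Rightarrow> 'h::{ring,monoid_mult} \<Rightarrow> 'h" +
  fixes \<alpha> :: "'a \<Rightarrow> 'h" and \<beta> :: "'a \<Rightarrow> 'h"
  assumes source_add: "a \<in> A \<Longrightarrow> b \<in> A \<Longrightarrow> \<alpha> (a + b) = \<alpha> a + \<alpha> b"
    and source_scale: "a \<in> A \<Longrightarrow> \<alpha> (scaleA c a) = scale c (\<alpha> a)"
    and source_one: "\<alpha> 1 = 1"
    and source_mult: "a \<in> A \<Longrightarrow> b \<in> A \<Longrightarrow> \<alpha> (a * b) = \<alpha> a * \<alpha> b"
    and target_add: "a \<in> A \<Longrightarrow> b \<in> A \<Longrightarrow> \<beta> (a + b) = \<beta> a + \<beta> b"
    and target_scale: "a \<in> A \<Longrightarrow> \<beta> (scaleA c a) = scale c (\<beta> a)"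
    and target_one: "\<beta> 1 = 1"
    and target_mult: "a \<in> A \<Longrightarrow> b \<in> A \<Longrightarrow> \<beta> (a * b) = \<beta> b * \<beta> a"
    and source_target_commute: "a \<in> A \<Longrightarrow> b \<in> A \<Longrightarrow> \<alpha> a * \<beta> b = \<beta> b * \<alpha> a"

locale algebra_bimodule =
  base: unital_subalgebra scaleA A + total: vector_space scale
  for scaleA :: "'k::field \<Rightarrow> 'a::{ring,monoid_mult} \<Rightarrow> 'a" and A :: "'a set"
    and scale :: "'k \<Rightarrow> 'h::ab_group_add \<Rightarrow> 'h" +
  fixes lact :: "'a \<Rightarrow> 'h \<Rightarrow> 'h" and ract :: "'h \<Rightarrow> 'a \<Rightarrow> 'h"
  assumes lact_linear: "a \<in> A \<Longrightarrow> Vector_Spaces.linear scale scale (lact a)"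
    and lact_add: "a \<in> A \<Longrightarrow> b \<in> A \<Longrightarrow> lact (a + b) h = lact a h + lact b h"
    and lact_scale: "a \<in> A \<Longrightarrow> lact (scaleA c a) h = scale c (lact a h)"
    and lact_one: "lact 1 h = h"
    and lact_mult: "a \<in> A \<Longrightarrow> b \<in> A \<Longrightarrow> lact (a * b) h = lact a (lact b h)"
    and ract_linear: "a \<in> A \<Longrightarrow> Vector_Spaces.linear scale scale (\<lambda>h. ract h a)"
    and ract_add: "a \<in> A \<Longrightarrow> b \<in> A \<Longrightarrow> ract h (a + b) = ract h a + ract h b"
    and ract_scale: "a \<in> A \<Longrightarrow> ract h (scaleA c a) = scale c (ract h a)"
    and ract_one: "ract h 1 = h"
    and ract_mult: "a \<in> A \<Longrightarrow> b \<in> A \<Longrightarrow> ract h (a * b) = ract (ract h a) b"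
    and lact_ract: "a \<in> A \<Longrightarrow> b \<in> A \<Longrightarrow> ract (lact a h) b = lact a (ract h b)"

locale coring = algebra_bimodule scaleA A scale lact ract
  for scaleA :: "'k::field \<Rightarrow> 'a::{ring,monoid_mult} \<Rightarrow> 'a" and A :: "'a set"
    and scale :: "'k \<Rightarrow> 'h::ab_group_add \<Rightarrow> 'h"
    and lact :: "'a \<Rightarrow> 'h \<Rightarrow> 'h" and ract :: "'h \<Rightarrow> 'a \<Rightarrow> 'h" +
  fixes \<Delta> :: "'h \<Rightarrow> ('h \<times> 'h) multiset set" and \<epsilon> :: "'h \<Rightarrow> 'a"
  assumes comult_linear: "tensor_linear (tensor_eq A ract lact) scale \<Delta>"
    and comult_bimodule: "a \<in> A \<Longrightarrow> b \<in> A \<Longrightarrow> \<Delta> (ract (lact a h) b)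
      = tensor_map (tensor_eq A ract lact) (image_mset (\<lambda>(x, y). (lact a x, ract y b))) (\<Delta> h)"
    and coassoc: "comult_left (tensor3_eq A ract lact) \<Delta> (\<Delta> h)
      = comult_right (tensor3_eq A ract lact) \<Delta> (\<Delta> h)"
    and counit_in: "\<epsilon> h \<in> A"
    and counit_linear: "Vector_Spaces.linear scale scaleA \<epsilon>"
    and counit_bimodule: "a \<in> A \<Longrightarrow> b \<in> A \<Longrightarrow> \<epsilon> (ract (lact a h) b) = a * \<epsilon> h * b"
    and counit_left: "tensor_lift (\<lambda>(h1, h2). lact (\<epsilon> h1) h2) (\<Delta> h) = h"
    and counit_right: "tensor_lift (\<lambda>(h1, h2). ract h1 (\<epsilon> h2)) (\<Delta> h) = h"

text \<open>The action of an algebra (the type \<open>'h\<close>) on the vector space \<open>A\<close>.\<close>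

definition algebra_action ::
    "('k \<Rightarrow> 'h::{ring,monoid_mult} \<Rightarrow> 'h) \<Rightarrow> ('k \<Rightarrow> 'a \<Rightarrow> 'a::ab_group_add) \<Rightarrow> 'a set
      \<Rightarrow> ('h \<Rightarrow> 'a \<Rightarrow> 'a) \<Rightarrow> bool" where
  "algebra_action scale scaleA A act \<longleftrightarrow>
     (\<forall>h. \<forall>a\<in>A. act h a \<in> A) \<and>
     (\<forall>h h'. \<forall>a\<in>A. act (h + h') a = act h a + act h' a) \<and>
     (\<forall>h. \<forall>a\<in>A. \<forall>b\<in>A. act h (a + b) = act h a + act h b) \<and>
     (\<forall>c h. \<forall>a\<in>A. act (scale c h) a = scaleA c (act h a) \<and> act h (scaleA c a) = scaleA c (act h a)) \<and>
     (\<forall>a\<in>A. act 1 a = a) \<and>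
     (\<forall>h h'. \<forall>a\<in>A. act (h * h') a = act h (act h' a))"

definition tensor_subspace ::
    "('k \<Rightarrow> 'h \<Rightarrow> 'h::ab_group_add) \<Rightarrow> ('h \<times> 'h) multiset set set \<Rightarrow> bool" where
  "tensor_subspace scale B \<longleftrightarrow>
     B \<subseteq> tensor_space (k_tensor_eq scale) \<and>
     tensor_class (k_tensor_eq scale) {#} \<in> B \<and>
     (\<forall>X\<in>B. \<forall>Y\<in>B. tensor_plus (k_tensor_eq scale) X Y \<in> B) \<and>
     (\<forall>c. \<forall>X\<in>B. tensor_scale (k_tensor_eq scale) scale c X \<in> B)"

definition tensor_subalgebra ::
    "('k \<Rightarrow> 'h \<Rightarrow> 'h::ring) \<Rightarrow> ('h \<times> 'h) multiset set set \<Rightarrow> bool" where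
  "tensor_subalgebra scale B \<longleftrightarrow>
     tensor_subspace scale B \<and> (\<forall>X\<in>B. \<forall>Y\<in>B. k_tensor_times scale X Y \<in> B)"

definition two_sided_ideal_in ::
    "('k \<Rightarrow> 'h \<Rightarrow> 'h::ring) \<Rightarrow> ('h \<times> 'h) multiset set set \<Rightarrow> ('h \<times> 'h) multiset set set \<Rightarrow> bool" where
  "two_sided_ideal_in scale J B \<longleftrightarrow>
     J \<subseteq> B \<and> tensor_subspace scale J \<and>
     (\<forall>X\<in>J. \<forall>Y\<in>B. k_tensor_times scale X Y \<in> J \<and> k_tensor_times scale Y X \<in> J)"

text \<open>The tensor product over \<open>A\<close> for the bimodule structure \<open>a.h.b = \<alpha>(a)\<beta>(b)h\<close>, the projection onto
  it from the tensor product over the field, and the kernel of this projection.\<close>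

abbreviation A_tensor_eq ::
    "'a set \<Rightarrow> ('a \<Rightarrow> 'h) \<Rightarrow> ('a \<Rightarrow> 'h) \<Rightarrow> (('h::ring \<times> 'h) multiset \<times> ('h \<times> 'h) multiset) set" where
  "A_tensor_eq A \<alpha> \<beta> \<equiv> tensor_eq A (\<lambda>h b. \<beta> b * h) (\<lambda>a h. \<alpha> a * h)"

definition tensor_proj ::
    "'a set \<Rightarrow> ('a \<Rightarrow> 'h) \<Rightarrow> ('a \<Rightarrow> 'h) \<Rightarrow> ('h::ring \<times> 'h) multiset set \<Rightarrow> ('h \<times> 'h) multiset set" where
  "tensor_proj A \<alpha> \<beta> = tensor_map (A_tensor_eq A \<alpha> \<beta>) (\<lambda>t. t)"

definition proj_kernel ::
    "('k \<Rightarrow> 'h \<Rightarrow> 'h::ring) \<Rightarrow> 'a set \<Rightarrow> ('a \<Rightarrow> 'h) \<Rightarrow> ('a \<Rightarrow> 'h) \<Rightarrow> ('h \<times> 'h) multiset set set" where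
  "proj_kernel scale A \<alpha> \<beta> = {X \<in> tensor_space (k_tensor_eq scale).
     tensor_proj A \<alpha> \<beta> X = tensor_class (A_tensor_eq A \<alpha> \<beta>) {#}}"

text \<open>In \<open>comult_multiplicative\<close> the product on \<open>B/(I \<inter> B)\<close>, identified with the image of \<open>B\<close>, is
  computed on representatives in \<open>B\<close>; likewise the left-hand side of \<open>antipode_right\<close> below.\<close>

locale balanced_bialgebroid =
  source_target scaleA A scale \<alpha> \<beta> +
  coring scaleA A scale "\<lambda>a h. \<alpha> a * h" "\<lambda>h b. \<beta> b * h" \<Delta> \<epsilon>
  for scaleA :: "'k::field \<Rightarrow> 'a::{ring,monoid_mult} \<Rightarrow> 'a" and A :: "'a set"
    and scale :: "'k \<Rightarrow> 'h::{ring,monoid_mult} \<Rightarrow> 'h"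
    and \<alpha> :: "'a \<Rightarrow> 'h" and \<beta> :: "'a \<Rightarrow> 'h"
    and \<Delta> :: "'h \<Rightarrow> ('h \<times> 'h) multiset set" and \<epsilon> :: "'h \<Rightarrow> 'a" +
  fixes B :: "('h \<times> 'h) multiset set set"
  assumes balancing_subalgebra: "tensor_subalgebra scale B"
    and base_action: "algebra_action scale scaleA A (\<lambda>h a. \<epsilon> (h * \<alpha> a))"
    and kernel_ideal: "two_sided_ideal_in scale (proj_kernel scale A \<alpha> \<beta> \<inter> B) B"
    and comult_in: "\<Delta> h \<in> tensor_proj A \<alpha> \<beta> ` B"
    and comult_multiplicative: "X \<in> B \<Longrightarrow> Y \<in> B \<Longrightarrow> tensor_proj A \<alpha> \<beta> X = \<Delta> h
      \<Longrightarrow> tensor_proj A \<alpha> \<beta> Y = \<Delta> h' \<Longrightarrow> \<Delta> (h * h') = tensor_proj A \<alpha> \<beta> (k_tensor_times scale X Y)"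
    and comult_unital: "\<Delta> 1 = tensor_class (A_tensor_eq A \<alpha> \<beta>) {#(1, 1)#}"

locale balanced_hopf_algebroid = balanced_bialgebroid scaleA A scale \<alpha> \<beta> \<Delta> \<epsilon> B
  for scaleA :: "'k::field \<Rightarrow> 'a::{ring,monoid_mult} \<Rightarrow> 'a" and A :: "'a set"
    and scale :: "'k \<Rightarrow> 'h::{ring,monoid_mult} \<Rightarrow> 'h"
    and \<alpha> :: "'a \<Rightarrow> 'h" and \<beta> :: "'a \<Rightarrow> 'h"
    and \<Delta> :: "'h \<Rightarrow> ('h \<times> 'h) multiset set" and \<epsilon> :: "'h \<Rightarrow> 'a"
    and B :: "('h \<times> 'h) multiset set set" +
  fixes \<tau> :: "'h \<Rightarrow> 'h"
  assumes antipode_linear: "Vector_Spaces.linear scale scale \<tau>"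
    and antipode_mult: "\<tau> (x * y) = \<tau> y * \<tau> x"
    and antipode_one: "\<tau> 1 = 1"
    and antipode_kernel: "X \<in> proj_kernel scale A \<alpha> \<beta> \<inter> B \<Longrightarrow> tensor_lift (\<lambda>(x, y). x * \<tau> y) X = 0"
    and antipode_target: "a \<in> A \<Longrightarrow> \<tau> (\<beta> a) = \<alpha> a"
    and antipode_right: "X \<in> B \<Longrightarrow> tensor_proj A \<alpha> \<beta> X = \<Delta> h
      \<Longrightarrow> tensor_lift (\<lambda>(x, y). x * \<tau> y) X = \<alpha> (\<epsilon> h)"
    and antipode_left: "tensor_lift (\<lambda>(x, y). \<tau> x * y) (\<Delta> h) = \<beta> (\<epsilon> (\<tau> h))"

end

theory Submission
  imports Defs
begin

text \<open>Write \<open>I\<close> for the kernel of the projection \<open>\<pi>\<close> and \<open>B = \<Delta>(1)(H \<otimes> H)\<Delta>(1)\<close>. Since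
  \<open>1\<^sub>(\<^sub>1\<^sub>) \<beta>(a) \<otimes> 1\<^sub>(\<^sub>2\<^sub>) = 1\<^sub>(\<^sub>1\<^sub>) \<otimes> 1\<^sub>(\<^sub>2\<^sub>) a\<close> for \<open>a\<close> in the base, left multiplication by \<open>\<Delta>(1)\<close>
  kills \<open>I\<close>; it is the identity on \<open>B\<close>, so \<open>I \<inter> B = 0\<close>, and every condition on representatives in
  \<open>B\<close> reduces to an identity for \<open>\<Delta>\<close> itself. Conversely \<open>\<pi>(\<Delta>(1) X) = \<pi>(X)\<close>, because the left leg of
  \<open>\<Delta>(1)\<close> lies in the image of \<open>\<beta>\<close> and can be moved across the tensor sign. The identities of \<open>S\<close>
  follow from \<open>S \<circ> \<beta> = id\<close> on the base, from anti-multiplicativity of \<open>S\<close>, and from bijectivity,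
  which lets one cancel \<open>S\<close>.

  Identities in \<open>H \<otimes> H\<close> are checked by evaluating \<open>H\<close>-valued bilinear maps on formal sums; over a
  field these separate tensors.\<close>

section \<open>Formal sums modulo a congruence\<close>

text \<open>In the quotient encoding every operation on tensors is a union over representatives, so
  each one must first be shown to respect its congruence. For twofold tensors over the field this is
  done by evaluation (\<open>k_tensor_eqI\<close>). Threefold tensors over the field occur only in
  the axioms that are given, so there one direction suffices: equal classes have equal trilinear
  values. Over the base \<open>A\<close> the proof has no such test, and equality has to be produced
  by relations. Hence the algebra is done over the field as far as possible, where Sweedler notation
  becomes the nested sums \<open>sw\<close>, and is transported along the inclusion of the scalar
  relations into those over \<open>A\<close>. Coassociativity over \<open>A\<close> is obtained in
  this way from one formal sum that represents both bracketings over the field. The two halves of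
  bijectivity enter at different places: surjectivity of \<open>S\<close> gives
  \<open>S 1 = 1\<close>; injectivity gives antimultiplicativity of \<open>\<beta>\<close> and the
  formula \<open>PR_eq_PLbar\<close> behind the last antipode axiom.\<close>

lemma equiv_congruence_closure: "equiv UNIV (congruence_closure R)"
proof (rule equivI)
  show "congruence_closure R \<subseteq> UNIV \<times> UNIV" by simp
  show "refl (congruence_closure R)" by (rule refl_onI) (rule congruence_closure.refl)
  show "sym (congruence_closure R)" by (rule symI) (rule congruence_closure.sym)
  show "trans (congruence_closure R)" by (rule transI) (rule congruence_closure.trans)
qed

lemma congruence_closure_add2:
  assumes "(s, t) \<in> congruence_closure R" "(s', t') \<in> congruence_closure R"
  shows "(s + s', t + t') \<in> congruence_closure R"
proof -
  have "(s + s', t + s') \<in> congruence_closure R"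
    using assms(1) by (rule congruence_closure.add)
  moreover have "(t + s', t + t') \<in> congruence_closure R"
    using congruence_closure.add[OF assms(2), of t] by (simp add: add.commute)
  ultimately show ?thesis by (rule congruence_closure.trans)
qed

lemma congruence_closure_sum_mset:
  assumes "\<And>x. x \<in># m \<Longrightarrow> (f x, g x) \<in> congruence_closure R"
  shows "((\<Sum>x\<in>#m. f x), (\<Sum>x\<in>#m. g x)) \<in> congruence_closure R"
  using assms by (induction m) (auto intro: congruence_closure.refl congruence_closure_add2)

lemma congruence_closure_sum:
  assumes "finite F" "\<And>x. x \<in> F \<Longrightarrow> (f x, g x) \<in> congruence_closure R"
  shows "((\<Sum>x\<in>F. f x), (\<Sum>x\<in>F. g x)) \<in> congruence_closure R"
  using assms by (induction F) (auto intro: congruence_closure.refl congruence_closure_add2)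

text \<open>Additivity carries the relation through the rule \<open>add\<close>, so well-definedness
  of a map between quotients becomes a check on generators.\<close>

lemma congruence_closure_map:
  assumes "(s, t) \<in> congruence_closure R"
    and "\<And>s t. (s, t) \<in> R \<Longrightarrow> (F s, F t) \<in> congruence_closure R'"
    and "\<And>s t. F (s + t) = F s + F t"
  shows "(F s, F t) \<in> congruence_closure R'"
  using assms(1)
proof induction
  case (base s t)
  then show ?case by (rule assms(2))
next
  case (add s t u)
  then show ?case by (simp add: assms(3) congruence_closure.add)
next
  case (trans s t u)
  then show ?case by (blast intro: congruence_closure.trans)
qed (rule congruence_closure.refl congruence_closure.sym, assumption?)+

lemma congruence_closure_eval:
  assumes "(s, t) \<in> congruence_closure R"
    and "\<And>s t. (s, t) \<in> R \<Longrightarrow> F s = F t"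
    and "\<And>s t. F (s + t) = F s + F t"
  shows "F s = F t"
  using assms(1) by induction (auto simp: assms(2,3))

lemma tensor_class_eq_iff:
  "tensor_class (congruence_closure R) s = tensor_class (congruence_closure R) t
    \<longleftrightarrow> (s, t) \<in> congruence_closure R"
  unfolding tensor_class_def by (rule eq_equiv_class_iff[OF equiv_congruence_closure]) auto

lemma in_tensor_class_iff:
  "t \<in> tensor_class (congruence_closure R) s \<longleftrightarrow> (s, t) \<in> congruence_closure R"
  by (simp add: tensor_class_def)

lemma tensor_class_self: "s \<in> tensor_class (congruence_closure R) s"
  by (simp add: in_tensor_class_iff congruence_closure.refl)

lemma tensor_class_in_space: "tensor_class E s \<in> tensor_space E"
  by (simp add: tensor_class_def quotientI)

lemma tensor_space_eq_class:
  assumes "X \<in> tensor_space (congruence_closure R)" "s \<in> X"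
  shows "X = tensor_class (congruence_closure R) s"
proof -
  obtain t where X: "X = tensor_class (congruence_closure R) t"
    using assms(1) by (auto simp: quotient_def tensor_class_def)
  with assms(2) show ?thesis
    by (simp add: in_tensor_class_iff tensor_class_eq_iff)
qed

lemma tensor_space_nonempty: "X \<in> tensor_space (congruence_closure R) \<Longrightarrow> \<exists>s. s \<in> X"
  using in_quotient_imp_non_empty[OF equiv_congruence_closure] by blast

lemma tensor_space_cases:
  assumes "X \<in> tensor_space (congruence_closure R)"
  obtains s where "X = tensor_class (congruence_closure R) s"
  using tensor_space_nonempty[OF assms] tensor_space_eq_class[OF assms] by blast

text \<open>A family that is constant on a class collapses to its value at one representative; all
  the unions that define tensor operations are evaluated through this.\<close>

lemma UNION_tensor_class:
  assumes "\<And>t. (s, t) \<in> congruence_closure R \<Longrightarrow> f t = f s"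
  shows "(\<Union>t\<in>tensor_class (congruence_closure R) s. f t) = f s"
  using tensor_class_self by (rule UN_constant_eq) (simp add: in_tensor_class_iff assms)

lemma tensor_map_class:
  assumes "\<And>t t'. (t, t') \<in> congruence_closure R \<Longrightarrow> (F t, F t') \<in> congruence_closure R'"
  shows "tensor_map (congruence_closure R') F (tensor_class (congruence_closure R) s)
    = tensor_class (congruence_closure R') (F s)"
  unfolding tensor_map_def
  by (rule UNION_tensor_class) (metis assms tensor_class_eq_iff)

lemma tensor_plus_class:
  "tensor_plus (congruence_closure R) (tensor_class (congruence_closure R) s)
      (tensor_class (congruence_closure R) t)
    = tensor_class (congruence_closure R) (s + t)"
proof -
  have "(\<Union>t'\<in>tensor_class (congruence_closure R) t. tensor_class (congruence_closure R) (s' + t'))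
      = tensor_class (congruence_closure R) (s' + t)" for s'
    by (rule UNION_tensor_class)
      (metis tensor_class_eq_iff congruence_closure_add2 congruence_closure.refl)
  moreover have "(\<Union>s'\<in>tensor_class (congruence_closure R) s. tensor_class (congruence_closure R) (s' + t))
      = tensor_class (congruence_closure R) (s + t)"
    by (rule UNION_tensor_class) (metis tensor_class_eq_iff congruence_closure.add)
  ultimately show ?thesis by (simp add: tensor_plus_def)
qed

lemma tensor_times_class:
  assumes "\<And>s s' t t'. (s, s') \<in> congruence_closure R \<Longrightarrow> (t, t') \<in> congruence_closure R \<Longrightarrow>
    ((\<Sum>u\<in>#s. image_mset (op u) t), (\<Sum>u\<in>#s'. image_mset (op u) t')) \<in> congruence_closure R"
  shows "tensor_times (congruence_closure R) op (tensor_class (congruence_closure R) s)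
      (tensor_class (congruence_closure R) t)
    = tensor_class (congruence_closure R) (\<Sum>u\<in>#s. image_mset (op u) t)"
proof -
  have "(\<Union>t'\<in>tensor_class (congruence_closure R) t.
        tensor_class (congruence_closure R) (\<Sum>u\<in>#s'. image_mset (op u) t'))
      = tensor_class (congruence_closure R) (\<Sum>u\<in>#s'. image_mset (op u) t)" for s'
    by (rule UNION_tensor_class) (metis tensor_class_eq_iff assms congruence_closure.refl)
  moreover have "(\<Union>s'\<in>tensor_class (congruence_closure R) s.
        tensor_class (congruence_closure R) (\<Sum>u\<in>#s'. image_mset (op u) t))
      = tensor_class (congruence_closure R) (\<Sum>u\<in>#s. image_mset (op u) t)"
    by (rule UNION_tensor_class) (metis tensor_class_eq_iff assms congruence_closure.refl)
  ultimately show ?thesis by (simp add: tensor_times_def)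
qed

lemma tensor_lift_class:
  assumes "\<And>t. (s, t) \<in> congruence_closure R \<Longrightarrow> (\<Sum>w\<in>#t. \<phi> w) = (\<Sum>w\<in>#s. \<phi> w)"
  shows "tensor_lift \<phi> (tensor_class (congruence_closure R) s) = (\<Sum>w\<in>#s. \<phi> w)"
proof -
  have "(\<lambda>t. \<Sum>w\<in>#t. \<phi> w) ` tensor_class (congruence_closure R) s
      = (\<lambda>t. \<Sum>w\<in>#s. \<phi> w) ` tensor_class (congruence_closure R) s"
    by (rule image_cong) (simp_all add: in_tensor_class_iff assms)
  also have "\<dots> = {\<Sum>w\<in>#s. \<phi> w}"
    using tensor_class_self[of s R] by (simp add: image_constant)
  finally show ?thesis by (simp add: tensor_lift_def)
qed

section \<open>Evaluation of formal sums\<close>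

text \<open>Curried, so that sums over several tensors nest and swap as in Sweedler
  notation.\<close>

definition tsum :: "('a \<times> 'b) multiset \<Rightarrow> ('a \<Rightarrow> 'b \<Rightarrow> 'c::comm_monoid_add) \<Rightarrow> 'c" where
  "tsum s \<phi> = (\<Sum>(x, y)\<in>#s. \<phi> x y)"

lemma tsum_simps [simp]:
  "tsum {#} \<phi> = 0"
  "tsum (add_mset (x, y) s) \<phi> = \<phi> x y + tsum s \<phi>"
  "tsum (s + t) \<phi> = tsum s \<phi> + tsum t \<phi>"
  by (simp_all add: tsum_def)

lemma tsum_zero [simp]: "tsum s (\<lambda>x y. 0) = 0"
  by (induction s) auto

lemma tsum_distrib: "tsum s (\<lambda>x y. \<phi> x y + \<psi> x y) = tsum s \<phi> + tsum s \<psi>"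
  by (induction s) (auto simp: algebra_simps)

lemma tsum_swap:
  "tsum s (\<lambda>a b. tsum t (\<lambda>c d. f a b c d)) = tsum t (\<lambda>c d. tsum s (\<lambda>a b. f a b c d))"
  by (induction s) (auto simp: tsum_distrib)

lemma tsum_hom:
  assumes "\<And>x y. f (x + y) = f x + f y" "f 0 = 0"
  shows "f (tsum s \<phi>) = tsum s (\<lambda>x y. f (\<phi> x y))"
  by (induction s) (auto simp: assms)

lemma tsum_image_mset:
  "tsum (image_mset (\<lambda>(x, y). (f x y, g x y)) s) \<phi> = tsum s (\<lambda>x y. \<phi> (f x y) (g x y))"
  by (induction s) auto

lemma tsum_times2:
  "tsum (\<Sum>u\<in>#s. image_mset (times2 u) t) \<phi>
    = tsum s (\<lambda>a b. tsum t (\<lambda>c d. \<phi> (a * c) (b * d)))"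
proof -
  have "tsum (image_mset (times2 (a, b)) t) \<phi> = tsum t (\<lambda>c d. \<phi> (a * c) (b * d))" for a b
    by (induction t) auto
  then show ?thesis by (induction s) auto
qed

lemma tensor_relators_cases:
  assumes "(s, t) \<in> tensor_relators R ract lact"
  obtains (add_left) x x' y where "s = {#(x + x', y)#}" "t = {#(x, y), (x', y)#}"
  | (add_right) x y y' where "s = {#(x, y + y')#}" "t = {#(x, y), (x, y')#}"
  | (zero_left) y where "s = {#(0, y)#}" "t = {#}"
  | (zero_right) x where "s = {#(x, 0)#}" "t = {#}"
  | (balance) x r y where "r \<in> R" "s = {#(ract x r, y)#}" "t = {#(x, lact r y)#}"
  using assms unfolding tensor_relators_def by blast

lemma tensor_relators_intros:
  "({#(x + x', y)#}, {#(x, y), (x', y)#}) \<in> tensor_relators R ract lact"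
  "({#(x, y + y')#}, {#(x, y), (x, y')#}) \<in> tensor_relators R ract lact"
  "({#(0, y)#}, {#}) \<in> tensor_relators R ract lact"
  "({#(x, 0)#}, {#}) \<in> tensor_relators R ract lact"
  "r \<in> R \<Longrightarrow> ({#(ract x r, y)#}, {#(x, lact r y)#}) \<in> tensor_relators R ract lact"
  unfolding tensor_relators_def by blast+

lemmas tensor_relations = tensor_relators_intros[THEN congruence_closure.base, folded tensor_eq_def]

lemma zero_of_additive:
  fixes f :: "'a::ab_group_add \<Rightarrow> 'b::ab_group_add"
  assumes "\<And>x y. f (x + y) = f x + f y"
  shows "f 0 = 0"
  using assms[of 0 0] by simp

text \<open>Compatibility with the two zero relators follows from additivity, because the values lie
  in a group.\<close>

lemma tsum_balanced:
  fixes \<phi> :: "'h::ab_group_add \<Rightarrow> 'h \<Rightarrow> 'c::ab_group_add"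
  assumes "(s, t) \<in> tensor_eq R ract lact"
    and l: "\<And>x x' y. \<phi> (x + x') y = \<phi> x y + \<phi> x' y"
    and r: "\<And>x y y'. \<phi> x (y + y') = \<phi> x y + \<phi> x y'"
    and b: "\<And>x r y. r \<in> R \<Longrightarrow> \<phi> (ract x r) y = \<phi> x (lact r y)"
  shows "tsum s \<phi> = tsum t \<phi>"
proof -
  have z: "\<phi> 0 y = 0" "\<phi> x 0 = 0" for x y
    using zero_of_additive[of "\<lambda>x. \<phi> x y"] zero_of_additive[of "\<phi> x"] l r by auto
  show ?thesis
    using assms(1) unfolding tensor_eq_def
  proof (rule congruence_closure_eval)
    fix s t assume "(s, t) \<in> tensor_relators R ract lact"
    then show "tsum s \<phi> = tsum t \<phi>"
      by (cases rule: tensor_relators_cases) (auto simp: l r b z)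
  qed simp
qed

lemma tensor_lift_balanced:
  fixes \<phi> :: "'h::ab_group_add \<Rightarrow> 'h \<Rightarrow> 'c::ab_group_add"
  assumes "\<And>x x' y. \<phi> (x + x') y = \<phi> x y + \<phi> x' y"
    and "\<And>x y y'. \<phi> x (y + y') = \<phi> x y + \<phi> x y'"
    and "\<And>x r y. r \<in> R \<Longrightarrow> \<phi> (ract x r) y = \<phi> x (lact r y)"
  shows "tensor_lift (\<lambda>(x, y). \<phi> x y) (tensor_class (tensor_eq R ract lact) s) = tsum s \<phi>"
  unfolding tensor_eq_def tsum_def
proof (rule tensor_lift_class)
  fix t assume "(s, t) \<in> congruence_closure (tensor_relators R ract lact)"
  then have "tsum s \<phi> = tsum t \<phi>"
    using tsum_balanced[of s t R ract lact \<phi>] assms by (simp add: tensor_eq_def)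
  then show "(\<Sum>(x, y)\<in>#t. \<phi> x y) = (\<Sum>(x, y)\<in>#s. \<phi> x y)" by (simp add: tsum_def)
qed

section \<open>Threefold tensor products\<close>

lemma tensor3_left:
  assumes "(s, t) \<in> tensor_eq R ract lact"
  shows "(image_mset (\<lambda>(x, y). (x, y, z)) s, image_mset (\<lambda>(x, y). (x, y, z)) t) \<in> tensor3_eq R ract lact"
  using assms unfolding tensor_eq_def tensor3_eq_def
  by (rule congruence_closure_map) (rule congruence_closure.base, blast, simp)

lemma tensor3_right:
  assumes "(s, t) \<in> tensor_eq R ract lact"
  shows "(image_mset (\<lambda>(y, z). (x, y, z)) s, image_mset (\<lambda>(y, z). (x, y, z)) t) \<in> tensor3_eq R ract lact"
  using assms unfolding tensor_eq_def tensor3_eq_def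
  by (rule congruence_closure_map) (rule congruence_closure.base, blast, simp)

lemma tensor3_relations:
  "({#(x + x', y, z)#}, {#(x, y, z), (x', y, z)#}) \<in> tensor3_eq R ract lact"
  "({#(x, y, z + z')#}, {#(x, y, z), (x, y, z')#}) \<in> tensor3_eq R ract lact"
  "({#(0, y, z)#}, {#}) \<in> tensor3_eq R ract lact"
  "({#(x, y, 0)#}, {#}) \<in> tensor3_eq R ract lact"
  "r \<in> R \<Longrightarrow> ({#(ract x r, y, z)#}, {#(x, lact r y, z)#}) \<in> tensor3_eq R ract lact"
  "r \<in> R \<Longrightarrow> ({#(x, ract y r, z)#}, {#(x, y, lact r z)#}) \<in> tensor3_eq R ract lact"
  using tensor3_left[OF tensor_relations(1)[of x x' y R ract lact], of z]
    tensor3_right[OF tensor_relations(2)[of y z z' R ract lact], of x]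
    tensor3_left[OF tensor_relations(3)[of y R ract lact], of z]
    tensor3_right[OF tensor_relations(4)[of y R ract lact], of x]
    tensor3_left[OF tensor_relations(5)[of r R ract x y lact], of z]
    tensor3_right[OF tensor_relations(5)[of r R ract y z lact], of x]
  by simp_all

definition tsum3 :: "('a \<times> 'b \<times> 'c) multiset \<Rightarrow> ('a \<Rightarrow> 'b \<Rightarrow> 'c \<Rightarrow> 'd::comm_monoid_add) \<Rightarrow> 'd" where
  "tsum3 s \<phi> = (\<Sum>(x, y, z)\<in>#s. \<phi> x y z)"

lemma tsum3_simps [simp]:
  "tsum3 {#} \<phi> = 0"
  "tsum3 (add_mset (x, y, z) s) \<phi> = \<phi> x y z + tsum3 s \<phi>"
  "tsum3 (s + t) \<phi> = tsum3 s \<phi> + tsum3 t \<phi>"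
  by (simp_all add: tsum3_def)

lemma tsum3_image_left:
  "tsum3 (image_mset (\<lambda>(x, y). (x, y, z)) s) \<phi> = tsum s (\<lambda>x y. \<phi> x y z)"
  by (induction s) auto

lemma tsum3_image_right:
  "tsum3 (image_mset (Pair x) s) \<phi> = tsum s (\<phi> x)"
  by (induction s) auto

lemma tsum3_comult_left:
  "tsum3 (\<Sum>(x, y)\<in>#t. image_mset (\<lambda>(u, v). (u, v, y)) (d x)) \<phi>
    = tsum t (\<lambda>x y. tsum (d x) (\<lambda>u v. \<phi> u v y))"
  by (induction t) (auto simp: tsum3_image_left)

lemma tsum3_comult_right:
  "tsum3 (\<Sum>(x, y)\<in>#t. image_mset (Pair x) (d y)) \<phi>
    = tsum t (\<lambda>x y. tsum (d y) (\<phi> x))"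
  by (induction t) (auto simp: tsum3_image_right)

lemma tsum3_times3:
  "tsum3 (\<Sum>u\<in>#s. image_mset (times3 u) t) \<phi>
    = tsum3 s (\<lambda>a b c. tsum3 t (\<lambda>a' b' c'. \<phi> (a * a') (b * b') (c * c')))"
proof -
  have "tsum3 (image_mset (times3 (a, b, c)) t) \<phi>
      = tsum3 t (\<lambda>a' b' c'. \<phi> (a * a') (b * b') (c * c'))" for a b c
    by (induction t) auto
  then show ?thesis by (induction s) auto
qed

lemma tsum3_balanced:
  fixes \<phi> :: "'h::ab_group_add \<Rightarrow> 'h \<Rightarrow> 'h \<Rightarrow> 'c::ab_group_add"
  assumes "(s, t) \<in> tensor3_eq R ract lact"
    and a: "\<And>x x' y z. \<phi> (x + x') y z = \<phi> x y z + \<phi> x' y z"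
      "\<And>x y y' z. \<phi> x (y + y') z = \<phi> x y z + \<phi> x y' z"
      "\<And>x y z z'. \<phi> x y (z + z') = \<phi> x y z + \<phi> x y z'"
    and b: "\<And>x r y z. r \<in> R \<Longrightarrow> \<phi> (ract x r) y z = \<phi> x (lact r y) z"
      "\<And>x r y z. r \<in> R \<Longrightarrow> \<phi> x (ract y r) z = \<phi> x y (lact r z)"
  shows "tsum3 s \<phi> = tsum3 t \<phi>"
  using assms(1) unfolding tensor3_eq_def
proof (rule congruence_closure_eval)
  fix s t
  assume "(s, t) \<in> {(image_mset (\<lambda>(x, y). (x, y, z)) s, image_mset (\<lambda>(x, y). (x, y, z)) t) | s t z.
         (s, t) \<in> tensor_relators R ract lact}
    \<union> {(image_mset (\<lambda>(y, z). (x, y, z)) s, image_mset (\<lambda>(y, z). (x, y, z)) t) | s t x.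
         (s, t) \<in> tensor_relators R ract lact}" (is "_ \<in> ?L \<union> ?R")
  then consider "(s, t) \<in> ?L" | "(s, t) \<in> ?R" by blast
  then show "tsum3 s \<phi> = tsum3 t \<phi>"
  proof cases
    case 1
    then obtain s' t' z where st: "s = image_mset (\<lambda>(x, y). (x, y, z)) s'"
        "t = image_mset (\<lambda>(x, y). (x, y, z)) t'" and rel: "(s', t') \<in> tensor_relators R ract lact"
      by blast
    have "tsum s' (\<lambda>x y. \<phi> x y z) = tsum t' (\<lambda>x y. \<phi> x y z)"
      by (rule tsum_balanced[where R = R and ract = ract and lact = lact])
        (auto simp: a b tensor_eq_def rel congruence_closure.base)
    then show ?thesis
      by (simp add: st tsum3_image_left tsum3_image_right)
  next
    case 2
    then obtain s' t' x where st: "s = image_mset (\<lambda>(y, z). (x, y, z)) s'"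
        "t = image_mset (\<lambda>(y, z). (x, y, z)) t'" and rel: "(s', t') \<in> tensor_relators R ract lact"
      by blast
    have "tsum s' (\<phi> x) = tsum t' (\<phi> x)"
      by (rule tsum_balanced[where R = R and ract = ract and lact = lact])
        (auto simp: a b tensor_eq_def rel congruence_closure.base)
    then show ?thesis
      by (simp add: st tsum3_image_left tsum3_image_right)
  qed
qed simp


lemma comult_left_memI:
  assumes "t \<in> X" "\<And>x. d x \<in> D x"
  shows "(\<Sum>(x, y)\<in>#t. image_mset (\<lambda>(u, v). (u, v, y)) (d x))
    \<in> comult_left (tensor3_eq R ract lact) D X"
  unfolding comult_left_def
proof (rule UN_I[OF assms(1)], rule UN_I)
  show "d \<in> {d. \<forall>x. d x \<in> D x}" using assms(2) by blast
qed (simp add: tensor3_eq_def tensor_class_self)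

section \<open>Bilinear maps separate tensors\<close>

context k_algebra
begin

abbreviation lin :: "('h \<Rightarrow> 'h) \<Rightarrow> bool" where
  "lin \<equiv> Vector_Spaces.linear scale scale"

lemma lin_iff: "lin f \<longleftrightarrow> (\<forall>x y. f (x + y) = f x + f y) \<and> (\<forall>c x. f (scale c x) = scale c (f x))"
  using vector_space_axioms by (simp add: Vector_Spaces.linear_iff)

lemma linD:
  assumes "lin f"
  shows "f (x + y) = f x + f y" "f (scale c x) = scale c (f x)" "f 0 = 0"
  using assms zero_of_additive[of f] by (auto simp: lin_iff)

lemma lin_tsum: "lin f \<Longrightarrow> f (tsum s \<phi>) = tsum s (\<lambda>x y. f (\<phi> x y))"
  by (rule tsum_hom) (simp_all add: linD)

definition bilin :: "('h \<Rightarrow> 'h \<Rightarrow> 'h) \<Rightarrow> bool" where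
  "bilin \<phi> \<longleftrightarrow> (\<forall>y. lin (\<lambda>x. \<phi> x y)) \<and> (\<forall>x. lin (\<lambda>y. \<phi> x y))"

lemma bilinI:
  assumes "\<And>y. lin (\<lambda>x. \<phi> x y)" "\<And>x. lin (\<lambda>y. \<phi> x y)"
  shows "bilin \<phi>"
  using assms by (simp add: bilin_def)

lemma bilinD:
  assumes "bilin \<phi>"
  shows "\<phi> (x + x') y = \<phi> x y + \<phi> x' y" "\<phi> x (y + y') = \<phi> x y + \<phi> x y'"
    "\<phi> (scale c x) y = scale c (\<phi> x y)" "\<phi> x (scale c y) = scale c (\<phi> x y)"
    "\<phi> 0 y = 0" "\<phi> x 0 = 0"
  using assms linD[of "\<lambda>x. \<phi> x y"] linD[of "\<lambda>y. \<phi> x y"] unfolding bilin_def by blast+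

lemma k_tensor_eq_tsum:
  assumes "(s, t) \<in> k_tensor_eq scale" "bilin \<phi>"
  shows "tsum s \<phi> = tsum t \<phi>"
  using assms(1) by (rule tsum_balanced) (simp_all add: bilinD[OF assms(2)])

lemma k_tensor_sum_left:
  assumes "finite F"
  shows "({#(\<Sum>b\<in>F. f b, y)#}, \<Sum>b\<in>F. {#(f b, y)#}) \<in> k_tensor_eq scale"
  using assms
proof (induction F)
  case empty
  then show ?case using tensor_relations(3) by simp
next
  case (insert b F)
  have "({#(f b + (\<Sum>b\<in>F. f b), y)#}, {#(f b, y)#} + {#(\<Sum>b\<in>F. f b, y)#}) \<in> k_tensor_eq scale"
    using tensor_relations(1)[of "f b" "\<Sum>b\<in>F. f b" y] by (simp add: add_mset_commute)
  moreover have "({#(f b, y)#} + {#(\<Sum>b\<in>F. f b, y)#}, {#(f b, y)#} + (\<Sum>b\<in>F. {#(f b, y)#}))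
      \<in> k_tensor_eq scale"
    using insert.IH unfolding tensor_eq_def
    by (intro congruence_closure_add2 congruence_closure.refl)
  ultimately show ?case
    using insert.hyps unfolding tensor_eq_def
    by (simp del: add_mset_add_single) (rule congruence_closure.trans)
qed

text \<open>Expanding the left factors in a basis \<open>b\<^sub>i\<close> brings every tensor to the form
  \<open>\<Sum>i. b\<^sub>i \<otimes> y\<^sub>i\<close>, whose coefficients \<open>y\<^sub>i\<close> are values of bilinear maps on the tensor.\<close>

lemma k_tensor_eqI:
  assumes "\<And>\<phi>. bilin \<phi> \<Longrightarrow> tsum s \<phi> = tsum t \<phi>"
  shows "(s, t) \<in> k_tensor_eq scale"
proof -
  define basis where "basis = extend_basis {}"
  have indep: "independent basis" and span: "span basis = UNIV"
    unfolding basis_def by (simp_all add: local.independent_extend_basis local.span_extend_basis local.independent_empty)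
  define r where "r = representation basis"
  define coord where "coord b x y = scale (r x b) y" for b x y
  have bil: "bilin (coord b)" for b
    using span unfolding bilin_def coord_def r_def
    by (simp add: lin_iff representation_add[OF indep] representation_scale[OF indep]
        algebra_simps scale_left_distrib scale_right_distrib scale_left_commute)
  have expand: "x = (\<Sum>b\<in>F. scale (r x b) b)" if "finite F" "{b. r x b \<noteq> 0} \<subseteq> F" for x F
  proof -
    have "x = (\<Sum>b | r x b \<noteq> 0. scale (r x b) b)"
      using sum_nonzero_representation_eq[OF indep, of x] span unfolding r_def by simp
    also have "\<dots> = (\<Sum>b\<in>F. scale (r x b) b)"
      using that by (intro sum.mono_neutral_left) auto
    finally show ?thesis .
  qed
  \<comment> \<open>\<open>F\<close> is any finite set containing the supports of the left factors,
    so that \<open>s\<close> and \<open>t\<close> can later be expanded over one common index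
    set.\<close>
  have normal_form: "(u, \<Sum>b\<in>F. {#(b, tsum u (coord b))#}) \<in> k_tensor_eq scale"
    if "finite F" "\<And>x y. (x, y) \<in># u \<Longrightarrow> {b. r x b \<noteq> 0} \<subseteq> F" for u F
    using that
  proof (induction u)
    case empty
    have "(\<Sum>b\<in>F. {#}, \<Sum>b\<in>F. {#(b, 0)#}) \<in> k_tensor_eq scale"
      unfolding tensor_eq_def
      by (rule congruence_closure_sum[OF that(1)], rule congruence_closure.sym)
        (rule tensor_relations(4)[unfolded tensor_eq_def])
    then show ?case by simp
  next
    case (add w u)
    obtain x y where w: "w = (x, y)" by (cases w)
    have 1: "({#(x, y)#}, \<Sum>b\<in>F. {#(scale (r x b) b, y)#}) \<in> k_tensor_eq scale"
      using k_tensor_sum_left[OF add.prems(1), of "\<lambda>b. scale (r x b) b" y]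
        expand[OF add.prems(1), of x] add.prems(2)[of x y] by (simp add: w)
    have 2: "(\<Sum>b\<in>F. {#(scale (r x b) b, y)#}, \<Sum>b\<in>F. {#(b, coord b x y)#}) \<in> k_tensor_eq scale"
      unfolding tensor_eq_def coord_def
      by (rule congruence_closure_sum[OF add.prems(1)])
        (rule tensor_relations(5)[OF UNIV_I, unfolded tensor_eq_def])
    have 3: "(u, \<Sum>b\<in>F. {#(b, tsum u (coord b))#}) \<in> k_tensor_eq scale"
    proof (rule add.IH[OF add.prems(1)])
      fix x y assume "(x, y) \<in># u"
      then have "(x, y) \<in># add_mset w u" by simp
      then show "{b. r x b \<noteq> 0} \<subseteq> F" by (rule add.prems(2))
    qed
    have 4: "((\<Sum>b\<in>F. {#(b, coord b x y)#}) + (\<Sum>b\<in>F. {#(b, tsum u (coord b))#}),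
        \<Sum>b\<in>F. {#(b, coord b x y + tsum u (coord b))#}) \<in> k_tensor_eq scale"
      unfolding tensor_eq_def sum.distrib[symmetric]
      by (rule congruence_closure_sum[OF add.prems(1)], rule congruence_closure.sym)
        (metis tensor_relations(2) add_mset_add_single tensor_eq_def union_commute)
    have "({#(x, y)#} + u, (\<Sum>b\<in>F. {#(b, coord b x y)#}) + (\<Sum>b\<in>F. {#(b, tsum u (coord b))#}))
        \<in> k_tensor_eq scale"
      using 1 2 3 unfolding tensor_eq_def
      by (blast intro: congruence_closure_add2 congruence_closure.trans)
    with 4 show ?case
      unfolding tensor_eq_def by (simp add: w) (rule congruence_closure.trans)
  qed
  define F where "F = (\<Union>(x, y)\<in>set_mset (s + t). {b. r x b \<noteq> 0})"
  have F: "finite F"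
    unfolding F_def r_def by (auto simp: finite_representation)
  have "(s, \<Sum>b\<in>F. {#(b, tsum s (coord b))#}) \<in> k_tensor_eq scale"
    by (rule normal_form[OF F]) (auto simp: F_def)
  moreover have "(t, \<Sum>b\<in>F. {#(b, tsum t (coord b))#}) \<in> k_tensor_eq scale"
    by (rule normal_form[OF F]) (auto simp: F_def)
  ultimately show ?thesis
    using assms[OF bil] unfolding tensor_eq_def
    by (simp) (blast intro: congruence_closure.sym congruence_closure.trans)
qed

lemma lin_id: "lin (\<lambda>x. x)"
  by (simp add: lin_iff)

lemma lin_scale: "lin f \<Longrightarrow> lin (\<lambda>x. scale c (f x))"
  by (simp add: lin_iff scale_right_distrib scale_left_commute)

lemma lin_functional:
  "Vector_Spaces.linear scale (*) f \<Longrightarrow> lin g \<Longrightarrow> lin (\<lambda>x. scale (f (g x)) w)"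
  by (simp add: Vector_Spaces.linear_iff scale_left_distrib)

lemma lin_compose: "lin g \<Longrightarrow> lin f \<Longrightarrow> lin (\<lambda>x. g (f x))"
  by (simp add: lin_iff)

lemma lin_tsum_arg: "(\<And>u v. lin (\<lambda>x. \<phi> x u v)) \<Longrightarrow> lin (\<lambda>x. tsum s (\<phi> x))"
proof (induction s)
  case empty
  then show ?case by (simp add: lin_iff)
next
  case (add w s)
  obtain u v where "w = (u, v)" by (cases w)
  then show ?case using add.IH[OF add.prems] add.prems[of u v] by (simp add: lin_iff algebra_simps)
qed

lemma bilin_left: "bilin \<phi> \<Longrightarrow> lin f \<Longrightarrow> lin (\<lambda>x. \<phi> (f x) y)"
  by (simp add: lin_iff bilinD)

lemma bilin_right: "bilin \<phi> \<Longrightarrow> lin f \<Longrightarrow> lin (\<lambda>x. \<phi> y (f x))"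
  by (simp add: lin_iff bilinD)

lemma lin_mult_left: "lin f \<Longrightarrow> lin (\<lambda>x. z * f x)"
  by (simp add: lin_iff distrib_left scale_mult_right)

lemma lin_mult_right: "lin f \<Longrightarrow> lin (\<lambda>x. f x * z)"
  by (simp add: lin_iff distrib_right scale_mult_left)

lemma k_tensor_times_respects:
  assumes "(s, s') \<in> k_tensor_eq scale" "(t, t') \<in> k_tensor_eq scale"
  shows "((\<Sum>u\<in>#s. image_mset (times2 u) t), (\<Sum>u\<in>#s'. image_mset (times2 u) t')) \<in> k_tensor_eq scale"
proof (rule k_tensor_eqI)
  fix \<phi> assume \<phi>: "bilin \<phi>"
  have "tsum s (\<lambda>a b. tsum t (\<lambda>c d. \<phi> (a * c) (b * d))) = tsum s' (\<lambda>a b. tsum t (\<lambda>c d. \<phi> (a * c) (b * d)))"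
    using assms(1) by (rule k_tensor_eq_tsum)
      (intro bilinI lin_tsum_arg bilin_left[OF \<phi>] bilin_right[OF \<phi>] lin_mult_left lin_mult_right lin_id)
  moreover have "tsum t (\<lambda>c d. \<phi> (a * c) (b * d)) = tsum t' (\<lambda>c d. \<phi> (a * c) (b * d))" for a b
    using assms(2) by (rule k_tensor_eq_tsum)
      (intro bilinI bilin_left[OF \<phi>] bilin_right[OF \<phi>] lin_mult_left lin_id)
  ultimately show "tsum (\<Sum>u\<in>#s. image_mset (times2 u) t) \<phi>
      = tsum (\<Sum>u\<in>#s'. image_mset (times2 u) t') \<phi>"
    by (simp add: tsum_times2)
qed

lemma k_tensor_times_class:
  "k_tensor_times scale (tensor_class (k_tensor_eq scale) s) (tensor_class (k_tensor_eq scale) t)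
    = tensor_class (k_tensor_eq scale) (\<Sum>u\<in>#s. image_mset (times2 u) t)"
  using k_tensor_times_respects unfolding tensor_eq_def by (rule tensor_times_class)


section \<open>Trilinear evaluation\<close>

definition trilin :: "('h \<Rightarrow> 'h \<Rightarrow> 'h \<Rightarrow> 'h) \<Rightarrow> bool" where
  "trilin \<phi> \<longleftrightarrow> (\<forall>y z. lin (\<lambda>x. \<phi> x y z)) \<and> (\<forall>x z. lin (\<lambda>y. \<phi> x y z)) \<and> (\<forall>x y. lin (\<lambda>z. \<phi> x y z))"

lemma trilinI:
  assumes "\<And>y z. lin (\<lambda>x. \<phi> x y z)" "\<And>x z. lin (\<lambda>y. \<phi> x y z)" "\<And>x y. lin (\<lambda>z. \<phi> x y z)"
  shows "trilin \<phi>"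
  using assms by (simp add: trilin_def)

lemma trilin_bilin:
  assumes "trilin \<phi>"
  shows "bilin (\<lambda>x y. \<phi> x y z)" "bilin (\<phi> x)"
  using assms by (simp_all add: trilin_def bilin_def)

lemma trilin_left: "trilin \<phi> \<Longrightarrow> lin f \<Longrightarrow> lin (\<lambda>x. \<phi> (f x) y z)"
  and trilin_middle: "trilin \<phi> \<Longrightarrow> lin f \<Longrightarrow> lin (\<lambda>y. \<phi> x (f y) z)"
  and trilin_right: "trilin \<phi> \<Longrightarrow> lin f \<Longrightarrow> lin (\<lambda>z. \<phi> x y (f z))"
  by (simp_all add: trilin_def lin_iff)

lemma k_tensor3_eq_tsum3:
  assumes "(s, t) \<in> k_tensor3_eq scale" "trilin \<phi>"
  shows "tsum3 s \<phi> = tsum3 t \<phi>"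
  using assms(1)
proof (rule tsum3_balanced)
qed (use assms(2) in \<open>simp_all add: trilin_def lin_iff\<close>)

lemma lin_tsum3_arg: "(\<And>u v w. lin (\<lambda>x. \<phi> x u v w)) \<Longrightarrow> lin (\<lambda>x. tsum3 s (\<phi> x))"
proof (induction s)
  case empty
  then show ?case by (simp add: lin_iff)
next
  case (add w s)
  obtain u v v' where "w = (u, v, v')" by (cases w)
  then show ?case using add.IH[OF add.prems] add.prems[of u v v'] by (simp add: lin_iff algebra_simps)
qed

text \<open>Formulated for every member of the product instead of as an equality of classes:
  whatever representatives produce it, its trilinear values are the same, and only these values are
  extracted from the unit axioms.\<close>

lemma k_tensor3_times_eval:
  assumes "q \<in> k_tensor3_times scale (tensor_class (k_tensor3_eq scale) s) (tensor_class (k_tensor3_eq scale) t)"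
    and \<phi>: "trilin \<phi>"
  shows "tsum3 q \<phi> = tsum3 s (\<lambda>a b c. tsum3 t (\<lambda>a' b' c'. \<phi> (a * a') (b * b') (c * c')))"
proof -
  obtain s' t' where s': "(s, s') \<in> k_tensor3_eq scale" and t': "(t, t') \<in> k_tensor3_eq scale"
    and q: "(\<Sum>u\<in>#s'. image_mset (times3 u) t', q) \<in> k_tensor3_eq scale"
    using assms(1) unfolding tensor_times_def tensor3_eq_def
    by (auto simp: in_tensor_class_iff)
  have "tsum3 q \<phi> = tsum3 s' (\<lambda>a b c. tsum3 t' (\<lambda>a' b' c'. \<phi> (a * a') (b * b') (c * c')))"
    using k_tensor3_eq_tsum3[OF q \<phi>] by (simp add: tsum3_times3)
  moreover have "tsum3 t (\<lambda>a' b' c'. \<phi> (a * a') (b * b') (c * c'))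
      = tsum3 t' (\<lambda>a' b' c'. \<phi> (a * a') (b * b') (c * c'))" for a b c
    using t' by (rule k_tensor3_eq_tsum3)
      (intro trilinI trilin_left[OF \<phi>] trilin_middle[OF \<phi>] trilin_right[OF \<phi>] lin_mult_left lin_id)
  moreover have "tsum3 s (\<lambda>a b c. tsum3 t' (\<lambda>a' b' c'. \<phi> (a * a') (b * b') (c * c')))
      = tsum3 s' (\<lambda>a b c. tsum3 t' (\<lambda>a' b' c'. \<phi> (a * a') (b * b') (c * c')))"
    using s' by (rule k_tensor3_eq_tsum3)
      (intro trilinI lin_tsum3_arg trilin_left[OF \<phi>] trilin_middle[OF \<phi>] trilin_right[OF \<phi>] lin_mult_right lin_id)
  ultimately show ?thesis by simp
qed

end


section \<open>Sweedler calculus in weak bialgebras\<close>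

context weak_bialgebra
begin

text \<open>One fixed representative per coproduct; by \<open>sw_eval\<close> bilinear maps take the
  same value on all the others.\<close>

definition rep :: "'h \<Rightarrow> ('h \<times> 'h) multiset" where
  "rep x = (SOME t. t \<in> \<Delta> x)"

text \<open>\<open>sw x (\<lambda>u v. \<phi> u v)\<close> stands for \<open>\<phi> x\<^sub>(\<^sub>1\<^sub>) x\<^sub>(\<^sub>2\<^sub>)\<close>.\<close>

definition sw :: "'h \<Rightarrow> ('h \<Rightarrow> 'h \<Rightarrow> 'c::comm_monoid_add) \<Rightarrow> 'c" where
  "sw x \<phi> = tsum (rep x) \<phi>"

lemma comult_in_space: "\<Delta> x \<in> tensor_space (k_tensor_eq scale)"
  using comult_linear by (simp add: tensor_linear_def)

lemma rep_in: "rep x \<in> \<Delta> x"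
  unfolding rep_def
  by (rule someI_ex) (rule tensor_space_nonempty[OF comult_in_space[unfolded tensor_eq_def]])

lemma comult_eq_class: "\<Delta> x = tensor_class (k_tensor_eq scale) (rep x)"
  unfolding tensor_eq_def
  by (rule tensor_space_eq_class[OF comult_in_space[unfolded tensor_eq_def] rep_in])

lemma in_comult_iff: "t \<in> \<Delta> x \<longleftrightarrow> (rep x, t) \<in> k_tensor_eq scale"
  by (subst comult_eq_class) (simp add: tensor_eq_def in_tensor_class_iff)

lemma sw_eval: "t \<in> \<Delta> x \<Longrightarrow> bilin \<phi> \<Longrightarrow> tsum t \<phi> = sw x \<phi>"
  unfolding sw_def in_comult_iff by (rule k_tensor_eq_tsum[symmetric])

lemma sw_add: "bilin \<phi> \<Longrightarrow> sw (x + y) \<phi> = sw x \<phi> + sw y \<phi>"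
proof -
  assume \<phi>: "bilin \<phi>"
  have "\<Delta> (x + y) = tensor_class (k_tensor_eq scale) (rep x + rep y)"
    using comult_linear unfolding tensor_linear_def
    by (simp add: comult_eq_class tensor_eq_def tensor_plus_class)
  then have "rep x + rep y \<in> \<Delta> (x + y)"
    by (simp add: tensor_eq_def tensor_class_self)
  from sw_eval[OF this \<phi>] show ?thesis by (simp add: sw_def)
qed

lemma scale_respects:
  assumes "(s, t) \<in> k_tensor_eq scale"
  shows "(image_mset (\<lambda>(x, y). (scale c x, y)) s, image_mset (\<lambda>(x, y). (scale c x, y)) t) \<in> k_tensor_eq scale"
proof (rule k_tensor_eqI)
  fix \<phi> assume \<phi>: "bilin \<phi>"
  show "tsum (image_mset (\<lambda>(x, y). (scale c x, y)) s) \<phi> = tsum (image_mset (\<lambda>(x, y). (scale c x, y)) t) \<phi>"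
    unfolding tsum_image_mset using assms by (rule k_tensor_eq_tsum)
      (intro bilinI bilin_left[OF \<phi>] bilin_right[OF \<phi>] lin_scale lin_id)
qed

lemma tensor_scale_class:
  "tensor_scale (k_tensor_eq scale) scale c (tensor_class (k_tensor_eq scale) s)
    = tensor_class (k_tensor_eq scale) (image_mset (\<lambda>(x, y). (scale c x, y)) s)"
  using scale_respects unfolding tensor_scale_def tensor_eq_def by (rule tensor_map_class)

lemma sw_scale: "bilin \<phi> \<Longrightarrow> sw (scale c x) \<phi> = scale c (sw x \<phi>)"
proof -
  assume \<phi>: "bilin \<phi>"
  have "\<Delta> (scale c x) = tensor_class (k_tensor_eq scale) (image_mset (\<lambda>(x, y). (scale c x, y)) (rep x))"
    using comult_linear unfolding tensor_linear_def by (simp add: comult_eq_class tensor_scale_class)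
  then have "image_mset (\<lambda>(x, y). (scale c x, y)) (rep x) \<in> \<Delta> (scale c x)"
    by (simp add: tensor_eq_def tensor_class_self)
  from sw_eval[OF this \<phi>] have "tsum (rep x) (\<lambda>x y. scale c (\<phi> x y)) = sw (scale c x) \<phi>"
    unfolding tsum_image_mset by (simp add: bilinD[OF \<phi>])
  then show ?thesis
    using lin_tsum[OF lin_scale[OF lin_id], of c "rep x" \<phi>] by (simp add: sw_def)
qed

lemma lin_sw: "bilin \<phi> \<Longrightarrow> lin f \<Longrightarrow> lin (\<lambda>x. sw (f x) \<phi>)"
  by (simp add: lin_iff sw_add sw_scale)

lemma lin_sw_arg: "(\<And>u v. lin (\<lambda>x. \<phi> x u v)) \<Longrightarrow> lin (\<lambda>x. sw y (\<phi> x))"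
  unfolding sw_def by (rule lin_tsum_arg)

lemmas lin_counit = lin_functional[OF counit_linear]

lemmas lin_intros = bilinI trilinI lin_id lin_scale lin_counit lin_mult_left lin_mult_right
  lin_sw_arg lin_sw

lemma sw_swap: "sw x (\<lambda>a b. sw y (\<lambda>c d. f a b c d)) = sw y (\<lambda>c d. sw x (\<lambda>a b. f a b c d))"
  unfolding sw_def by (rule tsum_swap)

lemma lin_sw_hom: "lin f \<Longrightarrow> f (sw x \<phi>) = sw x (\<lambda>u v. f (\<phi> u v))"
  unfolding sw_def by (rule lin_tsum)

lemma sw_mult_left: "z * sw x \<phi> = sw x (\<lambda>u v. z * \<phi> u v)" for z :: 'h
  using lin_sw_hom[OF lin_mult_left[OF lin_id]] .

lemma sw_mult_right: "sw x \<phi> * z = sw x (\<lambda>u v. \<phi> u v * z)" for z :: 'h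
  using lin_sw_hom[OF lin_mult_right[OF lin_id]] .

lemma sw_mult: "bilin \<phi> \<Longrightarrow> sw (x * y) \<phi> = sw x (\<lambda>a b. sw y (\<lambda>c d. \<phi> (a * c) (b * d)))"
proof -
  assume \<phi>: "bilin \<phi>"
  have "\<Delta> (x * y) = tensor_class (k_tensor_eq scale) (\<Sum>u\<in>#rep x. image_mset (times2 u) (rep y))"
    using comult_mult[of x y] by (simp add: comult_eq_class k_tensor_times_class)
  then have "(\<Sum>u\<in>#rep x. image_mset (times2 u) (rep y)) \<in> \<Delta> (x * y)"
    by (simp add: tensor_eq_def tensor_class_self)
  from sw_eval[OF this \<phi>] show ?thesis by (simp add: sw_def tsum_times2)
qed

lemma tensor_lift_comult: "bilin \<phi> \<Longrightarrow> tensor_lift (\<lambda>(u, v). \<phi> u v) (\<Delta> x) = sw x \<phi>"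
  unfolding sw_def
  by (subst comult_eq_class, rule tensor_lift_balanced) (simp_all add: bilinD)

lemma sw_counit_left: "sw x (\<lambda>u v. scale (\<epsilon> u) v) = x"
  using counit_left[of x] by (subst (asm) tensor_lift_comult) (intro lin_intros)

lemma sw_counit_right: "sw x (\<lambda>u v. scale (\<epsilon> v) u) = x"
  using counit_right[of x] by (subst (asm) tensor_lift_comult) (intro lin_intros)

lemma counit_simps:
  "\<epsilon> (x + y) = \<epsilon> x + \<epsilon> y" "\<epsilon> (scale c x) = c * \<epsilon> x" "\<epsilon> 0 = 0"
  using counit_linear zero_of_additive[of \<epsilon>] by (auto simp: Vector_Spaces.linear_iff)

lemma counit_sw: "\<epsilon> (sw x \<phi>) = sw x (\<lambda>u v. \<epsilon> (\<phi> u v))"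
  unfolding sw_def by (rule tsum_hom) (simp_all add: counit_simps)

lemma sw_counit_mult: "sw y (\<lambda>u v. \<epsilon> (x * u) * \<epsilon> (v * z)) = \<epsilon> (x * y * z)"
  unfolding sw_def
  by (subst counit_mult, subst comult_eq_class, rule tensor_lift_balanced[symmetric])
    (simp_all add: counit_simps algebra_simps scale_mult_left scale_mult_right)

lemma sw_counit_mult': "sw y (\<lambda>u v. \<epsilon> (x * v) * \<epsilon> (u * z)) = \<epsilon> (x * y * z)"
  unfolding sw_def
  by (subst counit_mult', subst comult_eq_class, rule tensor_lift_balanced[symmetric])
    (simp_all add: counit_simps algebra_simps scale_mult_left scale_mult_right)

section \<open>Coassociativity and the coproduct of the unit\<close>

text \<open>A member of the union comes from an arbitrary representative \<open>t\<close> and an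
  arbitrary choice \<open>d\<close>; the inner and the outer sum are replaced by \<open>sw\<close>
  one after the other.\<close>

lemma comult_left_eval:
  assumes "q \<in> comult_left (k_tensor3_eq scale) \<Delta> (\<Delta> x)" and \<phi>: "trilin \<phi>"
  shows "tsum3 q \<phi> = sw x (\<lambda>x1 x2. sw x1 (\<lambda>u v. \<phi> u v x2))"
proof -
  obtain t d where t: "t \<in> \<Delta> x" and d: "\<And>x. d x \<in> \<Delta> x"
    and q: "((\<Sum>(x, y)\<in>#t. image_mset (\<lambda>(u, v). (u, v, y)) (d x)), q) \<in> k_tensor3_eq scale"
    using assms(1) unfolding comult_left_def tensor3_eq_def by (auto simp: in_tensor_class_iff)
  have "tsum3 q \<phi> = tsum t (\<lambda>x1 x2. tsum (d x1) (\<lambda>u v. \<phi> u v x2))"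
    using k_tensor3_eq_tsum3[OF q \<phi>] by (simp add: tsum3_comult_left)
  also have "\<dots> = tsum t (\<lambda>x1 x2. sw x1 (\<lambda>u v. \<phi> u v x2))"
    by (simp add: sw_eval[OF d trilin_bilin(1)[OF \<phi>]])
  also have "\<dots> = sw x (\<lambda>x1 x2. sw x1 (\<lambda>u v. \<phi> u v x2))"
    using t by (rule sw_eval) (intro lin_intros trilin_left[OF \<phi>] trilin_middle[OF \<phi>] trilin_right[OF \<phi>])
  finally show ?thesis .
qed

lemma comult_right_eval:
  assumes "q \<in> comult_right (k_tensor3_eq scale) \<Delta> (\<Delta> x)" and \<phi>: "trilin \<phi>"
  shows "tsum3 q \<phi> = sw x (\<lambda>x1 x2. sw x2 (\<lambda>u v. \<phi> x1 u v))"
proof -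
  obtain t d where t: "t \<in> \<Delta> x" and d: "\<And>x. d x \<in> \<Delta> x"
    and q: "((\<Sum>(x, y)\<in>#t. image_mset (\<lambda>(u, v). (x, u, v)) (d y)), q) \<in> k_tensor3_eq scale"
    using assms(1) unfolding comult_right_def tensor3_eq_def by (auto simp: in_tensor_class_iff)
  have "tsum3 q \<phi> = tsum t (\<lambda>x1 x2. tsum (d x2) (\<phi> x1))"
    using k_tensor3_eq_tsum3[OF q \<phi>] by (simp add: tsum3_comult_right)
  also have "\<dots> = tsum t (\<lambda>x1 x2. sw x2 (\<phi> x1))"
    by (simp add: sw_eval[OF d trilin_bilin(2)[OF \<phi>]])
  also have "\<dots> = sw x (\<lambda>x1 x2. sw x2 (\<lambda>u v. \<phi> x1 u v))"
    using t by (rule sw_eval) (intro lin_intros trilin_left[OF \<phi>] trilin_middle[OF \<phi>] trilin_right[OF \<phi>])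
  finally show ?thesis .
qed

definition rep_left :: "'h \<Rightarrow> ('h \<times> 'h \<times> 'h) multiset" where
  "rep_left x = (\<Sum>(y, z)\<in>#rep x. image_mset (\<lambda>(u, v). (u, v, z)) (rep y))"

lemma rep_left_in: "rep_left x \<in> comult_left (k_tensor3_eq scale) \<Delta> (\<Delta> x)"
  unfolding rep_left_def using rep_in by (intro comult_left_memI)

text \<open>By \<open>coassoc\<close> the single formal sum \<open>rep_left x\<close> belongs to
  both iterated coproducts, and its value under \<open>\<phi>\<close> is computed from either
  side.\<close>

lemma sw_coassoc:
  assumes \<phi>: "trilin \<phi>"
  shows "sw x (\<lambda>x1 x2. sw x1 (\<lambda>u v. \<phi> u v x2)) = sw x (\<lambda>x1 x2. sw x2 (\<lambda>u v. \<phi> x1 u v))"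
  using comult_left_eval[OF rep_left_in \<phi>] comult_right_eval[OF _ \<phi>] rep_left_in coassoc by metis

lemma unit_legs:
  "tensor_map (k_tensor3_eq scale) (image_mset (\<lambda>(x, y). (x, y, 1))) (\<Delta> 1)
    = tensor_class (k_tensor3_eq scale) (image_mset (\<lambda>(x, y). (x, y, 1)) (rep 1))"
  "tensor_map (k_tensor3_eq scale) (image_mset (\<lambda>(x, y). (1, x, y))) (\<Delta> 1)
    = tensor_class (k_tensor3_eq scale) (image_mset (\<lambda>(x, y). (1, x, y)) (rep 1))"
proof -
  show "tensor_map (k_tensor3_eq scale) (image_mset (\<lambda>(x, y). (x, y, 1))) (\<Delta> 1)
    = tensor_class (k_tensor3_eq scale) (image_mset (\<lambda>(x, y). (x, y, 1)) (rep 1))"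
    using tensor3_left unfolding tensor_eq_def tensor3_eq_def
    by (subst comult_eq_class, unfold tensor_eq_def) (rule tensor_map_class)
  show "tensor_map (k_tensor3_eq scale) (image_mset (\<lambda>(x, y). (1, x, y))) (\<Delta> 1)
    = tensor_class (k_tensor3_eq scale) (image_mset (\<lambda>(x, y). (1, x, y)) (rep 1))"
    using tensor3_right unfolding tensor_eq_def tensor3_eq_def
    by (subst comult_eq_class, unfold tensor_eq_def) (rule tensor_map_class)
qed

text \<open>The two orders of \<open>\<Delta>(1) \<otimes> 1\<close> and
  \<open>1 \<otimes> \<Delta>(1)\<close> in the unit axiom differ only in the product formed in the
  middle factor.\<close>

lemma sw_one3:
  assumes \<phi>: "trilin \<phi>"
  shows "sw 1 (\<lambda>x1 x2. sw x1 (\<lambda>u v. \<phi> u v x2)) = sw 1 (\<lambda>a b. sw 1 (\<lambda>c d. \<phi> a (b * c) d))"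
    "sw 1 (\<lambda>x1 x2. sw x1 (\<lambda>u v. \<phi> u v x2)) = sw 1 (\<lambda>a b. sw 1 (\<lambda>c d. \<phi> a (c * b) d))"
proof -
  have eq: "tsum3 (rep_left 1) \<phi> = sw 1 (\<lambda>x1 x2. sw x1 (\<lambda>u v. \<phi> u v x2))"
    using rep_left_in \<phi> by (rule comult_left_eval)
  have "tsum3 (rep_left 1) \<phi> = sw 1 (\<lambda>a b. sw 1 (\<lambda>c d. \<phi> a (b * c) d))"
    using k_tensor3_times_eval[OF rep_left_in[of 1, unfolded comult_one unit_legs] \<phi>]
    by (simp add: tsum3_image_left tsum3_image_right sw_def)
  with eq show "sw 1 (\<lambda>x1 x2. sw x1 (\<lambda>u v. \<phi> u v x2)) = sw 1 (\<lambda>a b. sw 1 (\<lambda>c d. \<phi> a (b * c) d))"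
    by simp
  have "tsum3 (rep_left 1) \<phi> = sw 1 (\<lambda>c d. sw 1 (\<lambda>a b. \<phi> a (c * b) d))"
    using k_tensor3_times_eval[OF rep_left_in[of 1, unfolded comult_one' unit_legs] \<phi>]
    by (simp add: tsum3_image_left tsum3_image_right sw_def)
  also have "\<dots> = sw 1 (\<lambda>a b. sw 1 (\<lambda>c d. \<phi> a (c * b) d))"
    by (rule sw_swap)
  finally show "sw 1 (\<lambda>x1 x2. sw x1 (\<lambda>u v. \<phi> u v x2)) = sw 1 (\<lambda>a b. sw 1 (\<lambda>c d. \<phi> a (c * b) d))"
    using eq by simp
qed

end

section \<open>The base algebras of a weak Hopf algebra\<close>

context weak_bialgebra
begin

text \<open>The right leg of \<open>\<Delta> 1\<close>, cut out by all linear functionals on its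
  left leg. In this form values of \<open>PL\<close> belong to it at once, and the proofs below use
  only linearity of \<open>f\<close>.\<close>

definition left_base :: "'h set" where
  "left_base = {sw 1 (\<lambda>u v. scale (f u) v) | f. Vector_Spaces.linear scale (*) f}"

text \<open>The left leg of \<open>\<Delta> 1\<close>; both \<open>PLbar\<close> and
  \<open>PR\<close> take their values in it.\<close>

definition right_base :: "'h set" where
  "right_base = {sw 1 (\<lambda>u v. scale (f v) u) | f. Vector_Spaces.linear scale (*) f}"

lemma sw_scale_arg: "scale c (sw x \<phi>) = sw x (\<lambda>u v. scale c (\<phi> u v))"
  using lin_sw_hom[OF lin_scale[OF lin_id]] .

text \<open>Apply the functional behind \<open>a\<close> to the first factor of the threefold
  coproduct of 1. The two orders in the unit axiom give
  \<open>\<Delta>(a) = (a \<otimes> 1) \<Delta>(1)\<close> and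
  \<open>\<Delta>(a) = \<Delta>(1) (a \<otimes> 1)\<close>.\<close>

lemma sw_left_base_unit:
  assumes "a \<in> left_base" and \<phi>: "bilin \<phi>"
  shows "sw a \<phi> = sw 1 (\<lambda>u v. \<phi> (a * u) v)" "sw a \<phi> = sw 1 (\<lambda>u v. \<phi> (u * a) v)"
proof -
  obtain f where f: "Vector_Spaces.linear scale (*) f" and a: "a = sw 1 (\<lambda>u v. scale (f u) v)"
    using assms(1) by (auto simp: left_base_def)
  note lin = lin_intros lin_functional[OF f] bilin_left[OF \<phi>] bilin_right[OF \<phi>]
  have tri: "trilin (\<lambda>p q v. scale (f p) (\<phi> q v))" by (intro lin)
  have "sw a \<phi> = sw 1 (\<lambda>u v. sw (scale (f u) v) \<phi>)"
    unfolding a by (rule lin_sw_hom) (intro lin \<phi>)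
  also have "\<dots> = sw 1 (\<lambda>u v. sw v (\<lambda>p q. scale (f u) (\<phi> p q)))"
    by (simp add: sw_scale[OF \<phi>] sw_scale_arg)
  also have "\<dots> = sw 1 (\<lambda>u v. sw u (\<lambda>p q. scale (f p) (\<phi> q v)))"
    by (rule sw_coassoc[OF tri, symmetric])
  finally have eq: "sw a \<phi> = sw 1 (\<lambda>u v. sw u (\<lambda>p q. scale (f p) (\<phi> q v)))" .
  have "sw 1 (\<lambda>p q. scale (f p) (\<phi> (q * c) e)) = \<phi> (a * c) e" for c e
    unfolding a by (subst lin_sw_hom[where f = "\<lambda>x. \<phi> (x * c) e"]) (intro lin, simp add: bilinD[OF \<phi>] scale_mult_left)
  then show "sw a \<phi> = sw 1 (\<lambda>u v. \<phi> (a * u) v)"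
    unfolding eq sw_one3(1)[OF tri] by (subst sw_swap) simp
  have "sw 1 (\<lambda>p q. scale (f p) (\<phi> (c * q) e)) = \<phi> (c * a) e" for c e
    unfolding a by (subst lin_sw_hom[where f = "\<lambda>x. \<phi> (c * x) e"]) (intro lin, simp add: bilinD[OF \<phi>] scale_mult_right)
  then show "sw a \<phi> = sw 1 (\<lambda>u v. \<phi> (u * a) v)"
    unfolding eq sw_one3(2)[OF tri] by (subst sw_swap) simp
qed

text \<open>Here the functional acts on the third factor, so the unit axiom applies directly; its
  second order leaves \<open>y\<close> on the left, which gives
  \<open>\<Delta>(y) = (1 \<otimes> y) \<Delta>(1)\<close>.\<close>

lemma sw_right_base_unit:
  assumes "y \<in> right_base" and \<phi>: "bilin \<phi>"
  shows "sw y \<phi> = sw 1 (\<lambda>u v. \<phi> u (y * v))"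
proof -
  obtain f where f: "Vector_Spaces.linear scale (*) f" and y: "y = sw 1 (\<lambda>u v. scale (f v) u)"
    using assms(1) by (auto simp: right_base_def)
  note lin = lin_intros lin_functional[OF f] bilin_left[OF \<phi>] bilin_right[OF \<phi>]
  have tri: "trilin (\<lambda>p q v. scale (f v) (\<phi> p q))" by (intro lin)
  have "sw y \<phi> = sw 1 (\<lambda>u v. sw (scale (f v) u) \<phi>)"
    unfolding y by (rule lin_sw_hom) (intro lin \<phi>)
  also have "\<dots> = sw 1 (\<lambda>u v. sw u (\<lambda>p q. scale (f v) (\<phi> p q)))"
    by (simp add: sw_scale[OF \<phi>] sw_scale_arg)
  also have "\<dots> = sw 1 (\<lambda>a b. sw 1 (\<lambda>c d. scale (f d) (\<phi> a (c * b))))"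
    by (rule sw_one3(2)[OF tri])
  also have "\<dots> = sw 1 (\<lambda>a b. \<phi> a (y * b))"
    unfolding y
    by (subst lin_sw_hom[where f = "\<lambda>x. \<phi> _ (x * _)"]) (intro lin, simp add: bilinD[OF \<phi>] scale_mult_left)
  finally show ?thesis .
qed

text \<open>The factor \<open>\<Delta>(1)\<close> in \<open>sw_left_base_unit\<close> is absorbed by
  \<open>\<Delta>(h)\<close>, because \<open>1 * h = h\<close> and \<open>h * 1 = h\<close>.\<close>

lemma sw_left_base:
  assumes "a \<in> left_base" and \<phi>: "bilin \<phi>"
  shows "sw (a * h) \<phi> = sw h (\<lambda>u v. \<phi> (a * u) v)" "sw (h * a) \<phi> = sw h (\<lambda>u v. \<phi> (u * a) v)"
proof -
  note lin = lin_intros bilin_left[OF \<phi>] bilin_right[OF \<phi>]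
  have "sw (a * h) \<phi> = sw a (\<lambda>p q. sw h (\<lambda>u v. \<phi> (p * u) (q * v)))"
    by (rule sw_mult[OF \<phi>])
  also have "\<dots> = sw 1 (\<lambda>p q. sw h (\<lambda>u v. \<phi> (a * p * u) (q * v)))"
    by (rule sw_left_base_unit[OF assms(1)]) (intro lin)
  also have "\<dots> = sw 1 (\<lambda>p q. sw h (\<lambda>u v. \<phi> (a * (p * u)) (q * v)))"
    by (simp add: mult.assoc)
  also have "\<dots> = sw (1 * h) (\<lambda>u v. \<phi> (a * u) v)"
    by (rule sw_mult[symmetric]) (intro lin)
  finally show "sw (a * h) \<phi> = sw h (\<lambda>u v. \<phi> (a * u) v)" by simp
  have "sw (h * a) \<phi> = sw h (\<lambda>u v. sw a (\<lambda>p q. \<phi> (u * p) (v * q)))"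
    by (rule sw_mult[OF \<phi>])
  also have "\<dots> = sw h (\<lambda>u v. sw 1 (\<lambda>p q. \<phi> (u * (p * a)) (v * q)))"
    by (subst sw_left_base_unit(2)[OF assms(1)]) (intro lin, simp)
  also have "\<dots> = sw h (\<lambda>u v. sw 1 (\<lambda>p q. \<phi> (u * p * a) (v * q)))"
    by (simp add: mult.assoc)
  also have "\<dots> = sw (h * 1) (\<lambda>u v. \<phi> (u * a) v)"
    by (rule sw_mult[symmetric]) (intro lin)
  finally show "sw (h * a) \<phi> = sw h (\<lambda>u v. \<phi> (u * a) v)" by simp
qed

lemma sw_right_base:
  assumes "y \<in> right_base" and \<phi>: "bilin \<phi>"
  shows "sw (y * h) \<phi> = sw h (\<lambda>u v. \<phi> u (y * v))"
proof -
  note lin = lin_intros bilin_left[OF \<phi>] bilin_right[OF \<phi>]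
  have "sw (y * h) \<phi> = sw y (\<lambda>p q. sw h (\<lambda>u v. \<phi> (p * u) (q * v)))"
    by (rule sw_mult[OF \<phi>])
  also have "\<dots> = sw 1 (\<lambda>p q. sw h (\<lambda>u v. \<phi> (p * u) (y * q * v)))"
    by (rule sw_right_base_unit[OF assms(1)]) (intro lin)
  also have "\<dots> = sw 1 (\<lambda>p q. sw h (\<lambda>u v. \<phi> (p * u) (y * (q * v))))"
    by (simp add: mult.assoc)
  also have "\<dots> = sw (1 * h) (\<lambda>u v. \<phi> u (y * v))"
    by (rule sw_mult[symmetric]) (intro lin)
  finally show ?thesis by simp
qed

text \<open>Apply \<open>f\<close> and \<open>g\<close> to the outer factors of the threefold
  coproduct of 1: the middle factor becomes \<open>a * y\<close> or \<open>y * a\<close> according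
  to the order in the unit axiom.\<close>

lemma left_right_base_commute:
  assumes "a \<in> left_base" "y \<in> right_base"
  shows "a * y = y * a"
proof -
  obtain f g where f: "Vector_Spaces.linear scale (*) f" and a: "a = sw 1 (\<lambda>u v. scale (f u) v)"
    and g: "Vector_Spaces.linear scale (*) g" and y: "y = sw 1 (\<lambda>u v. scale (g v) u)"
    using assms by (auto simp: left_base_def right_base_def)
  have tri: "trilin (\<lambda>p q v. scale (f p) (scale (g v) q))"
    by (intro lin_intros lin_functional[OF f] lin_functional[OF g])
  have "a * y = sw 1 (\<lambda>p q. sw 1 (\<lambda>u v. scale (f p) (scale (g v) (q * u))))"
    unfolding a y
    by (subst sw_mult_right) (simp add: sw_mult_left scale_mult_left scale_mult_right sw_scale_arg
        mult.commute[of "g v" "f p" for p v])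
  also have "\<dots> = sw 1 (\<lambda>p q. sw 1 (\<lambda>u v. scale (f p) (scale (g v) (u * q))))"
    using sw_one3[OF tri] by simp
  also have "\<dots> = y * a"
    unfolding a y
    by (subst sw_swap, subst sw_mult_right)
      (simp add: sw_mult_left scale_mult_left scale_mult_right sw_scale_arg
        mult.commute[of "f p" "g v" for p v])
  finally show ?thesis .
qed

section \<open>The counital maps\<close>

abbreviation PL :: "'h \<Rightarrow> 'h" where
  "PL \<equiv> Pi_L scale \<Delta> \<epsilon>"

abbreviation PLbar :: "'h \<Rightarrow> 'h" where
  "PLbar \<equiv> Pi_L_bar scale \<Delta> \<epsilon>"

text \<open>The right counital map, that is, the value of \<open>S(x_(1)) x_(2)\<close> in the
  antipode axiom; \<open>PR_eq_PLbar\<close> expresses it by the maps of the theorem.\<close>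

definition PR :: "'h \<Rightarrow> 'h" where
  "PR x = sw 1 (\<lambda>u v. scale (\<epsilon> (x * v)) u)"

lemma PL_eq: "PL x = sw 1 (\<lambda>u v. scale (\<epsilon> (u * x)) v)"
  unfolding Pi_L_def by (rule tensor_lift_comult) (intro lin_intros)

lemma PLbar_eq: "PLbar x = sw 1 (\<lambda>u v. scale (\<epsilon> (v * x)) u)"
  unfolding Pi_L_bar_def by (rule tensor_lift_comult) (intro lin_intros)

lemma functional_mult:
  "Vector_Spaces.linear scale (*) (\<lambda>u. \<epsilon> (u * x))" "Vector_Spaces.linear scale (*) (\<lambda>u. \<epsilon> (x * u))"
  using counit_linear
  by (auto simp: Vector_Spaces.linear_iff scale_mult_left scale_mult_right distrib_left distrib_right)

lemma PL_in: "PL x \<in> left_base"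
  unfolding PL_eq left_base_def
  by (rule CollectI, rule exI[of _ "\<lambda>u. \<epsilon> (u * x)"]) (simp add: functional_mult)

lemma PLbar_in: "PLbar x \<in> right_base"
  unfolding PLbar_eq right_base_def
  by (rule CollectI, rule exI[of _ "\<lambda>u. \<epsilon> (u * x)"]) (simp add: functional_mult)

lemma PR_in: "PR x \<in> right_base"
  unfolding PR_def right_base_def
  by (rule CollectI, rule exI[of _ "\<lambda>u. \<epsilon> (x * u)"]) (simp add: functional_mult)

lemma lin_PL: "lin f \<Longrightarrow> lin (\<lambda>x. PL (f x))"
  unfolding PL_eq by (intro lin_intros)

lemma lin_PLbar: "lin f \<Longrightarrow> lin (\<lambda>x. PLbar (f x))"
  unfolding PLbar_eq by (intro lin_intros)

lemma lin_PR: "lin f \<Longrightarrow> lin (\<lambda>x. PR (f x))"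
  unfolding PR_def by (intro lin_intros)

lemma PL_one: "PL 1 = 1" and PLbar_one: "PLbar 1 = 1"
  by (simp_all add: PL_eq PLbar_eq sw_counit_left sw_counit_right)

text \<open>Weak multiplicativity of the counit with 1 as middle element; the leg of
  \<open>\<Delta> 1\<close> that the counital map keeps decides which of the two forms
  applies.\<close>

lemma counit_PL: "\<epsilon> (w * PL x) = \<epsilon> (w * x)"
  using sw_counit_mult'[where x = w and y = 1 and z = x]
  by (simp add: PL_eq sw_mult_left counit_sw scale_mult_right counit_simps mult.commute)

lemma counit_PLbar: "\<epsilon> (w * PLbar x) = \<epsilon> (w * x)"
  using sw_counit_mult[where x = w and y = 1 and z = x]
  by (simp add: PLbar_eq sw_mult_left counit_sw scale_mult_right counit_simps mult.commute)

lemma counit_PR: "\<epsilon> (PR x * w) = \<epsilon> (x * w)"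
  using sw_counit_mult'[where x = x and y = 1 and z = w]
  by (simp add: PR_def sw_mult_right counit_sw scale_mult_left counit_simps)

text \<open>\<open>PL x\<close> depends on \<open>x\<close> only through the functional
  \<open>\<epsilon>(w * x)\<close> in \<open>w\<close>, and by \<open>counit_PL\<close> replacing
  \<open>x\<close> by \<open>PL x\<close> does not change it. This makes the base a module over the
  whole algebra.\<close>

lemma PL_mult_PL: "PL (h * PL x) = PL (h * x)"
  unfolding PL_eq[of "h * PL x"] PL_eq[of "h * x"] by (simp add: mult.assoc[symmetric] counit_PL)

lemma PL_mult_PLbar: "PL (h * PLbar x) = PL (h * x)"
  unfolding PL_eq by (simp add: mult.assoc[symmetric] counit_PLbar)

lemma PLbar_mult_PL: "PLbar (h * PL x) = PLbar (h * x)"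
  unfolding PLbar_eq by (simp add: mult.assoc[symmetric] counit_PL)

lemma PR_mult_PR: "PR (PR x * h) = PR (x * h)"
  unfolding PR_def[of "PR x * h"] PR_def[of "x * h"] by (simp add: mult.assoc counit_PR)

lemma PL_PL: "PL (PL x) = PL x"
  using PL_mult_PL[of 1] by simp

lemma PL_PLbar: "PL (PLbar x) = PL x"
  using PL_mult_PLbar[of 1] by simp

lemma PLbar_PL: "PLbar (PL x) = PLbar x"
  using PLbar_mult_PL[of 1] by simp

text \<open>Expanding \<open>PL\<close> produces the tensor
  \<open>\<Delta>(1) \<Delta>(h) = \<Delta>(h)\<close>, to which the counit law applies.\<close>

lemma sw_PL_left: "sw h (\<lambda>u v. PL u * v) = h"
proof -
  have "sw h (\<lambda>u v. PL u * v) = sw h (\<lambda>u v. sw 1 (\<lambda>p q. scale (\<epsilon> (p * u)) (q * v)))"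
    by (simp add: PL_eq sw_mult_right scale_mult_left)
  also have "\<dots> = sw 1 (\<lambda>p q. sw h (\<lambda>u v. scale (\<epsilon> (p * u)) (q * v)))"
    by (rule sw_swap)
  also have "\<dots> = sw (1 * h) (\<lambda>p q. scale (\<epsilon> p) q)"
    by (rule sw_mult[symmetric]) (intro lin_intros)
  finally show ?thesis by (simp add: sw_counit_left)
qed

lemma sw_PLbar_right: "sw h (\<lambda>u v. PLbar v * u) = h"
proof -
  have "sw h (\<lambda>u v. PLbar v * u) = sw h (\<lambda>u v. sw 1 (\<lambda>p q. scale (\<epsilon> (q * v)) (p * u)))"
    by (simp add: PLbar_eq sw_mult_right scale_mult_left)
  also have "\<dots> = sw 1 (\<lambda>p q. sw h (\<lambda>u v. scale (\<epsilon> (q * v)) (p * u)))"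
    by (rule sw_swap)
  also have "\<dots> = sw (1 * h) (\<lambda>p q. scale (\<epsilon> q) p)"
    by (rule sw_mult[symmetric]) (intro lin_intros)
  finally show ?thesis by (simp add: sw_counit_right)
qed

text \<open>Insert the counit into the first factor of \<open>1_(1) x \<otimes> 1_(2)\<close> and
  split by the unit axiom: one copy of \<open>\<Delta>(1)\<close> is absorbed by \<open>x\<close>,
  the other combines with the counit to \<open>PL(x_(2))\<close>. This is the source of
  \<open>sw_one_balanced\<close>.\<close>

lemma sw_PL_right:
  assumes \<phi>: "bilin \<phi>"
  shows "sw x (\<lambda>u v. \<phi> u (PL v)) = sw 1 (\<lambda>u v. \<phi> (u * x) v)"
proof -
  note lin = lin_intros bilin_left[OF \<phi>] bilin_right[OF \<phi>]
  \<comment> \<open>The counit law for \<open>u * x\<close>, with the two legs of \<open>u\<close>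
    left as free arguments \<open>p\<close> and \<open>q\<close>, so that the unit axiom can act on
    them.\<close>
  define \<psi> where "\<psi> p q v = sw x (\<lambda>c d. scale (\<epsilon> (q * d)) (\<phi> (p * c) v))" for p q v
  have tri: "trilin \<psi>" unfolding \<psi>_def by (intro lin)
  have "sw (u * x) (\<lambda>p q. scale (\<epsilon> q) (\<phi> p v)) = \<phi> (u * x) v" for u v
    using lin_sw_hom[where f = "\<lambda>p. \<phi> p v" and x = "u * x" and \<phi> = "\<lambda>p q. scale (\<epsilon> q) p",
        OF bilin_left[OF \<phi> lin_id]]
    by (simp add: sw_counit_right bilinD[OF \<phi>])
  moreover have "sw (u * x) (\<lambda>p q. scale (\<epsilon> q) (\<phi> p v)) = sw u (\<lambda>p q. \<psi> p q v)" for u v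
    unfolding \<psi>_def by (rule sw_mult) (intro lin)
  ultimately have "sw 1 (\<lambda>u v. \<phi> (u * x) v) = sw 1 (\<lambda>u v. sw u (\<lambda>p q. \<psi> p q v))"
    by simp
  also have "\<dots> = sw 1 (\<lambda>a b. sw 1 (\<lambda>c e. \<psi> a (c * b) e))"
    by (rule sw_one3(2)[OF tri])
  also have "\<dots> = sw 1 (\<lambda>c e. sw 1 (\<lambda>a b. sw x (\<lambda>p q. scale (\<epsilon> (c * (b * q))) (\<phi> (a * p) e))))"
    unfolding \<psi>_def by (subst sw_swap) (simp add: mult.assoc)
  also have "\<dots> = sw 1 (\<lambda>c e. sw (1 * x) (\<lambda>p q. scale (\<epsilon> (c * q)) (\<phi> p e)))"
    by (subst sw_mult[of _ 1 x]) (intro lin, simp)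
  also have "\<dots> = sw x (\<lambda>p q. sw 1 (\<lambda>c e. scale (\<epsilon> (c * q)) (\<phi> p e)))"
    by (subst sw_swap) simp
  also have "\<dots> = sw x (\<lambda>u v. \<phi> u (PL v))"
    unfolding PL_eq by (subst lin_sw_hom[OF bilin_right[OF \<phi> lin_id]]) (simp add: bilinD[OF \<phi>])
  finally show ?thesis by simp
qed

text \<open>A counit in the middle factor of the unit axiom collapses one copy of
  \<open>\<Delta>(1)\<close> to \<open>PLbar\<close>, applied to the left leg of the other
  copy.\<close>

lemma sw_one_PLbar_left:
  assumes \<phi>: "bilin \<phi>"
  shows "sw 1 (\<lambda>u v. \<phi> (PLbar u) v) = sw 1 \<phi>"
proof -
  note lin = lin_intros bilin_left[OF \<phi>] bilin_right[OF \<phi>]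
  have tri: "trilin (\<lambda>a b e. scale (\<epsilon> b) (\<phi> a e))" by (intro lin)
  have "sw u (\<lambda>a b. scale (\<epsilon> b) (\<phi> a v)) = \<phi> u v" for u v
    using lin_sw_hom[where f = "\<lambda>p. \<phi> p v" and x = u and \<phi> = "\<lambda>p q. scale (\<epsilon> q) p",
        OF bilin_left[OF \<phi> lin_id]]
    by (simp add: sw_counit_right bilinD[OF \<phi>])
  then have "sw 1 \<phi> = sw 1 (\<lambda>u v. sw u (\<lambda>a b. scale (\<epsilon> b) (\<phi> a v)))"
    by simp
  also have "\<dots> = sw 1 (\<lambda>a b. sw 1 (\<lambda>c e. scale (\<epsilon> (b * c)) (\<phi> a e)))"
    by (rule sw_one3(1)[OF tri])
  also have "\<dots> = sw 1 (\<lambda>c e. sw 1 (\<lambda>a b. scale (\<epsilon> (b * c)) (\<phi> a e)))"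
    by (rule sw_swap)
  also have "\<dots> = sw 1 (\<lambda>u v. \<phi> (PLbar u) v)"
    unfolding PLbar_eq
    by (subst lin_sw_hom[OF bilin_left[OF \<phi> lin_id]]) (simp add: bilinD[OF \<phi>])
  finally show ?thesis by simp
qed

end


section \<open>The antipode\<close>

context weak_hopf_algebra
begin

lemma lin_antipode: "lin f \<Longrightarrow> lin (\<lambda>x. S (f x))"
  using lin_compose[OF antipode_linear] .

lemmas antipode_lin_intros = lin_intros lin_antipode lin_PL lin_PR lin_PLbar

lemma sw_antipode_right: "sw x (\<lambda>u v. u * S v) = PL x"
  unfolding Pi_L_def antipode_right[symmetric]
  by (rule tensor_lift_comult[symmetric]) (intro antipode_lin_intros)

lemma sw_antipode_left: "sw x (\<lambda>u v. S u * v) = PR x"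
proof -
  have "sw x (\<lambda>u v. S u * v) = tensor_lift (\<lambda>(u, v). scale (\<epsilon> (x * v)) u) (\<Delta> 1)"
    unfolding antipode_left[symmetric]
    by (rule tensor_lift_comult[symmetric]) (intro antipode_lin_intros)
  also have "\<dots> = PR x"
    unfolding PR_def by (rule tensor_lift_comult) (intro antipode_lin_intros)
  finally show ?thesis .
qed

text \<open>The lift extracts the only element of the image of a whole class; trilinear evaluation
  shows that this image is constant, and \<open>rep_left\<close> that it is nonempty.\<close>

lemma sw_antipode_both: "sw x (\<lambda>x1 x2. sw x1 (\<lambda>u v. S u * v * S x2)) = S x"
proof -
  let ?\<phi> = "\<lambda>u v w. S u * v * S w"
  have tri: "trilin ?\<phi>" by (intro antipode_lin_intros)
  have "(\<lambda>q. tsum3 q ?\<phi>) ` comult_left (k_tensor3_eq scale) \<Delta> (\<Delta> x)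
      = (\<lambda>q. sw x (\<lambda>x1 x2. sw x1 (\<lambda>u v. ?\<phi> u v x2))) ` comult_left (k_tensor3_eq scale) \<Delta> (\<Delta> x)"
    by (rule image_cong) (simp_all add: comult_left_eval[OF _ tri])
  also have "\<dots> = {sw x (\<lambda>x1 x2. sw x1 (\<lambda>u v. ?\<phi> u v x2))}"
    using rep_left_in by (rule image_constant)
  finally have "tensor_lift (\<lambda>(u, v, w). ?\<phi> u v w) (comult_left (k_tensor3_eq scale) \<Delta> (\<Delta> x))
      = sw x (\<lambda>x1 x2. sw x1 (\<lambda>u v. ?\<phi> u v x2))"
    by (simp add: tensor_lift_def tsum3_def)
  then show ?thesis using antipode_both[of x] by simp
qed

text \<open>Group the first two factors of \<open>S(x_(1)) x_(2) S(x_(3))\<close>; grouping the last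
  two gives \<open>antipode_PL\<close>.\<close>

lemma antipode_PR: "sw x (\<lambda>u v. PR u * S v) = S x"
  using sw_antipode_both[of x] by (simp add: sw_mult_right[symmetric] sw_antipode_left)

lemma antipode_PL: "sw x (\<lambda>u v. S u * PL v) = S x"
proof -
  have "S x = sw x (\<lambda>x1 x2. sw x1 (\<lambda>u v. S u * v * S x2))"
    by (rule sw_antipode_both[symmetric])
  also have "\<dots> = sw x (\<lambda>x1 x2. sw x2 (\<lambda>u v. S x1 * u * S v))"
    by (rule sw_coassoc) (intro antipode_lin_intros)
  also have "\<dots> = sw x (\<lambda>u v. S u * PL v)"
    by (simp add: mult.assoc sw_mult_left[symmetric] sw_antipode_right)
  finally show ?thesis by simp
qed

text \<open>\<open>PL\<close> is the convolution \<open>x_(1) S(x_(2))\<close>, and the coproduct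
  keeps \<open>a\<close> in front of the first leg.\<close>

lemma PL_left_base_mult: "a \<in> left_base \<Longrightarrow> PL (a * h) = a * PL h"
proof -
  assume a: "a \<in> left_base"
  have "PL (a * h) = sw (a * h) (\<lambda>u v. u * S v)"
    by (rule sw_antipode_right[symmetric])
  also have "\<dots> = sw h (\<lambda>u v. a * u * S v)"
    by (rule sw_left_base(1)[OF a]) (intro antipode_lin_intros)
  also have "\<dots> = a * PL h"
    by (simp add: mult.assoc sw_mult_left[symmetric] sw_antipode_right)
  finally show ?thesis .
qed

text \<open>The coproduct appends \<open>PL y\<close> to the first leg of \<open>x\<close>. In
  \<open>antipode_mult\<close> this inserts \<open>y_(2) S(y_(3))\<close> between
  \<open>x_(2)\<close> and \<open>S(x_(3))\<close>.\<close>

lemma PL_mult_eq_sw: "sw x (\<lambda>u v. u * PL y * S v) = PL (x * y)"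
proof -
  have "PL (x * y) = sw (x * PL y) (\<lambda>u v. u * S v)"
    by (simp add: sw_antipode_right PL_mult_PL)
  also have "\<dots> = sw x (\<lambda>u v. u * PL y * S v)"
    by (rule sw_left_base(2)[OF PL_in]) (intro antipode_lin_intros)
  finally show ?thesis by simp
qed

lemma PR_right_base_mult: "w \<in> right_base \<Longrightarrow> sw y (\<lambda>u v. S u * w * v) = PR (w * y)"
proof -
  assume w: "w \<in> right_base"
  have "PR (w * y) = sw (w * y) (\<lambda>u v. S u * v)"
    by (rule sw_antipode_left[symmetric])
  also have "\<dots> = sw y (\<lambda>u v. S u * (w * v))"
    by (rule sw_right_base[OF w]) (intro antipode_lin_intros)
  finally show ?thesis by (simp add: mult.assoc)
qed

text \<open>Coassociativity turns \<open>S(y_(1)) w y_(2) S(y_(3))\<close> into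
  \<open>S(y_(1)) w PL(y_(2))\<close>; as \<open>w\<close> commutes with the left base, it moves to
  the end, and what remains is \<open>S y\<close>.\<close>

lemma antipode_right_base:
  assumes w: "w \<in> right_base"
  shows "sw y (\<lambda>c n. PR (w * c) * S n) = S y * w"
proof -
  have "sw y (\<lambda>c n. PR (w * c) * S n) = sw y (\<lambda>c n. sw c (\<lambda>u v. S u * w * v * S n))"
    by (simp add: PR_right_base_mult[OF w, symmetric] sw_mult_right)
  also have "\<dots> = sw y (\<lambda>u e. sw e (\<lambda>v n. S u * w * v * S n))"
    by (rule sw_coassoc) (intro antipode_lin_intros)
  also have "\<dots> = sw y (\<lambda>u e. S u * w * PL e)"
    by (simp add: mult.assoc sw_mult_left[symmetric] sw_antipode_right)
  also have "\<dots> = sw y (\<lambda>u e. S u * PL e * w)"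
    by (simp add: mult.assoc left_right_base_commute[OF PL_in w])
  also have "\<dots> = S y * w"
    by (simp add: sw_mult_right[symmetric] antipode_PL)
  finally show ?thesis .
qed

text \<open>Both \<open>S (x y)\<close> and \<open>S y S x\<close> equal
  \<open>S (x\<^sub>(\<^sub>1\<^sub>) y\<^sub>(\<^sub>1\<^sub>)) x\<^sub>(\<^sub>2\<^sub>) y\<^sub>(\<^sub>2\<^sub>) S (y\<^sub>(\<^sub>3\<^sub>)) S (x\<^sub>(\<^sub>3\<^sub>))\<close>.\<close>

lemma antipode_mult: "S (x * y) = S y * S x"
proof -
  have "S (x * y) = sw (x * y) (\<lambda>u v. S u * PL v)"
    by (rule antipode_PL[symmetric])
  also have "\<dots> = sw x (\<lambda>a b. sw y (\<lambda>c d. S (a * c) * PL (b * d)))"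
    by (rule sw_mult) (intro antipode_lin_intros)
  also have "\<dots> = sw x (\<lambda>a b. sw y (\<lambda>c d. sw b (\<lambda>p q. sw d (\<lambda>m n. S (a * c) * p * m * S n * S q))))"
  proof -
    have "z * PL (b * d) = sw b (\<lambda>p q. sw d (\<lambda>m n. z * p * m * S n * S q))" for z b d
      unfolding PL_mult_eq_sw[symmetric] sw_antipode_right[symmetric, of d]
      by (simp add: sw_mult_left sw_mult_right mult.assoc)
    then show ?thesis by simp
  qed
  also have "\<dots> = sw x (\<lambda>a b. sw b (\<lambda>p q. sw y (\<lambda>c d. sw d (\<lambda>m n. S (a * c) * p * m * S n * S q))))"
    by (subst (2) sw_swap) simp
  also have "\<dots> = sw x (\<lambda>a b. sw b (\<lambda>p q. sw y (\<lambda>c n. sw c (\<lambda>u m. S (a * u) * p * m * S n * S q))))"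
  proof -
    have "sw y (\<lambda>c d. sw d (\<lambda>m n. S (a * c) * p * m * S n * S q))
        = sw y (\<lambda>c n. sw c (\<lambda>u m. S (a * u) * p * m * S n * S q))" for a p q
      by (rule sw_coassoc[symmetric]) (intro antipode_lin_intros)
    then show ?thesis by simp
  qed
  also have "\<dots> = sw x (\<lambda>a q. sw a (\<lambda>u p. sw y (\<lambda>c n. sw c (\<lambda>v m. S (u * v) * p * m * S n * S q))))"
    by (rule sw_coassoc[symmetric]) (intro antipode_lin_intros)
  also have "\<dots> = sw x (\<lambda>a q. sw y (\<lambda>c n. sw a (\<lambda>u p. sw c (\<lambda>v m. S (u * v) * (p * m) * (S n * S q)))))"
    by (subst (2) sw_swap) (simp add: mult.assoc)
  also have "\<dots> = sw x (\<lambda>a q. sw y (\<lambda>c n. PR (a * c) * (S n * S q)))"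
  proof -
    have "sw a (\<lambda>u p. sw c (\<lambda>v m. S (u * v) * (p * m) * z)) = PR (a * c) * z" for a c z
    proof -
      have "PR (a * c) = sw a (\<lambda>u p. sw c (\<lambda>v m. S (u * v) * (p * m)))"
        unfolding sw_antipode_left[symmetric] by (rule sw_mult) (intro antipode_lin_intros)
      then show ?thesis by (simp add: sw_mult_right)
    qed
    then show ?thesis by simp
  qed
  \<comment> \<open>Replacing \<open>PR (a * c)\<close> by \<open>PR (PR a * c)\<close> puts an
    element of the right base in front of \<open>c\<close>, the form that
    \<open>antipode_right_base\<close> requires.\<close>
  also have "\<dots> = sw x (\<lambda>a q. sw y (\<lambda>c n. PR (PR a * c) * S n) * S q)"
    by (simp add: PR_mult_PR sw_mult_right mult.assoc)
  also have "\<dots> = sw x (\<lambda>a q. S y * (PR a * S q))"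
    by (simp add: antipode_right_base[OF PR_in] mult.assoc)
  also have "\<dots> = S y * S x"
    by (simp add: sw_mult_left[symmetric] antipode_PR)
  finally show ?thesis .
qed

section \<open>The antipode on the base algebras\<close>

text \<open>By antimultiplicativity \<open>S 1\<close> is a left unit for the image of
  \<open>S\<close>, and surjectivity puts 1 into that image.\<close>

lemma antipode_one: "surj S \<Longrightarrow> S 1 = 1"
proof -
  assume "surj S"
  then obtain x where x: "S x = 1" by (metis surjD)
  have "S 1 = S 1 * S x" by (simp add: x)
  also have "\<dots> = S (x * 1)" by (rule antipode_mult[symmetric])
  finally show ?thesis by (simp add: x)
qed

text \<open>Now \<open>y\<close> enters the second leg, where \<open>S\<close> reverses the product;
  left multiplication therefore comes out on the right.\<close>

lemma PL_right_base_mult: "y \<in> right_base \<Longrightarrow> PL (y * h) = PL h * S y"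
proof -
  assume y: "y \<in> right_base"
  have "PL (y * h) = sw (y * h) (\<lambda>u v. u * S v)"
    by (rule sw_antipode_right[symmetric])
  also have "\<dots> = sw h (\<lambda>u v. u * S (y * v))"
    by (rule sw_right_base[OF y]) (intro antipode_lin_intros)
  also have "\<dots> = PL h * S y"
    by (simp add: antipode_mult mult.assoc[symmetric] sw_mult_right[symmetric] sw_antipode_right)
  finally show ?thesis .
qed

lemma antipode_right_base_eq: "y \<in> right_base \<Longrightarrow> S y = PL y"
  using PL_right_base_mult[of y 1] by (simp add: PL_one)

lemma antipode_PLbar: "S (PLbar x) = PL x"
  by (simp add: antipode_right_base_eq PLbar_in PL_PLbar)

text \<open>Both sides equal \<open>PL\<close> of \<open>S(h_(1)) h_(2)\<close>, since inside
  \<open>PL\<close> a right factor may be replaced by its own \<open>PL\<close>.\<close>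

lemma antipode_of_PR: "S (PR h) = PL (S h)"
proof -
  have "PL (S h) = sw h (\<lambda>u v. PL (S u * PL v))"
    by (subst antipode_PL[symmetric], rule lin_sw_hom) (intro antipode_lin_intros)
  also have "\<dots> = sw h (\<lambda>u v. PL (S u * v))"
    by (simp add: PL_mult_PL)
  also have "\<dots> = PL (PR h)"
    by (subst sw_antipode_left[symmetric], rule lin_sw_hom[symmetric]) (intro antipode_lin_intros)
  finally show ?thesis by (simp add: antipode_right_base_eq PR_in)
qed

text \<open>\<open>S\<close> sends both sides to \<open>PL (S h)\<close>, and injectivity cancels
  it.\<close>

lemma PR_eq_PLbar: "inj S \<Longrightarrow> PR h = PLbar (PL (S h))"
  using antipode_of_PR[of h] antipode_PLbar[of "PL (S h)"] by (metis PL_PL injD)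

text \<open>After applying \<open>S\<close>, which undoes \<open>PLbar\<close> on the base and
  reverses products, both sides become \<open>a * b\<close>.\<close>

lemma PLbar_mult: "inj S \<Longrightarrow> a = PL a \<Longrightarrow> b = PL b \<Longrightarrow> PLbar (a * b) = PLbar b * PLbar a"
proof -
  assume S: "inj S" and a: "a = PL a" and b: "b = PL b"
  have "S (PLbar (a * b)) = PL (PL a * b)"
    using a by (simp add: antipode_PLbar)
  also have "\<dots> = PL a * PL b"
    by (rule PL_left_base_mult[OF PL_in])
  also have "\<dots> = S (PLbar b * PLbar a)"
    by (simp add: antipode_mult antipode_PLbar)
  finally show ?thesis using S by (simp add: inj_eq)
qed

text \<open>Two evaluations of \<open>y_(1) \<otimes> PL(y_(2))\<close> at
  \<open>y = PLbar a\<close>: by \<open>sw_PL_right\<close>, and by moving \<open>y\<close> into the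
  second leg, where \<open>PL\<close> turns it into right multiplication by
  \<open>S y = PL a\<close>.\<close>

lemma sw_one_balanced:
  assumes \<phi>: "bilin \<phi>"
  shows "sw 1 (\<lambda>u v. \<phi> (u * PLbar a) v) = sw 1 (\<lambda>u v. \<phi> u (v * PL a))"
proof -
  note lin = antipode_lin_intros bilin_left[OF \<phi>] bilin_right[OF \<phi>]
  have "sw 1 (\<lambda>u v. \<phi> (u * PLbar a) v) = sw (PLbar a) (\<lambda>u v. \<phi> u (PL v))"
    by (rule sw_PL_right[OF \<phi>, symmetric])
  also have "\<dots> = sw (PLbar a * 1) (\<lambda>u v. \<phi> u (PL v))"
    by simp
  also have "\<dots> = sw 1 (\<lambda>u v. \<phi> u (PL (PLbar a * v)))"
    by (rule sw_right_base[OF PLbar_in]) (intro lin)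
  also have "\<dots> = sw 1 (\<lambda>u v. \<phi> u (PL v * PL a))"
    by (simp add: PL_right_base_mult PLbar_in antipode_PLbar)
  also have "\<dots> = sw 1 (\<lambda>u v. \<phi> (u * 1) (v * PL a))"
    by (rule sw_PL_right[where \<phi> = "\<lambda>u v. \<phi> u (v * PL a)"]) (intro lin)
  finally show ?thesis by simp
qed

end


section \<open>The Hopf algebroid of a weak Hopf algebra\<close>

lemma congruence_closure_mono:
  assumes "R \<subseteq> R'"
  shows "congruence_closure R \<subseteq> congruence_closure R'"
proof -
  have "(s, t) \<in> congruence_closure R'" if "(s, t) \<in> congruence_closure R" for s t
    using that by (rule congruence_closure_map[where F = "\<lambda>s. s"]) (use assms in \<open>auto intro: congruence_closure.base\<close>)
  then show ?thesis by auto
qed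

lemma tensor_eq_mono:
  "tensor_relators R ract lact \<subseteq> tensor_relators R' ract' lact' \<Longrightarrow>
    tensor_eq R ract lact \<subseteq> tensor_eq R' ract' lact'"
  unfolding tensor_eq_def by (rule congruence_closure_mono)

lemma tensor3_eq_mono:
  assumes "tensor_relators R ract lact \<subseteq> tensor_relators R' ract' lact'"
  shows "tensor3_eq R ract lact \<subseteq> tensor3_eq R' ract' lact'"
  unfolding tensor3_eq_def by (rule congruence_closure_mono) (use assms in blast)

lemma tensor_eq_map:
  assumes "(s, t) \<in> tensor_eq R ract lact"
    and f: "\<And>x y. f (x + y) = f x + f y" "\<And>r x. r \<in> R \<Longrightarrow> f (ract x r) = ract (f x) r"
    and g: "\<And>x y. g (x + y) = g x + g y" "\<And>r x. r \<in> R \<Longrightarrow> g (lact r x) = lact r (g x)"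
  shows "(image_mset (\<lambda>(x, y). (f x, g y)) s, image_mset (\<lambda>(x, y). (f x, g y)) t) \<in> tensor_eq R ract lact"
  using assms(1) unfolding tensor_eq_def
proof (rule congruence_closure_map)
  have z: "f 0 = 0" "g 0 = 0"
    using f g by (simp_all add: zero_of_additive)
  fix s t assume "(s, t) \<in> tensor_relators R ract lact"
  then show "(image_mset (\<lambda>(x, y). (f x, g y)) s, image_mset (\<lambda>(x, y). (f x, g y)) t)
      \<in> congruence_closure (tensor_relators R ract lact)"
    by (cases rule: tensor_relators_cases)
      (simp_all add: f g z tensor_relators_intros congruence_closure.base)
qed simp

locale bijective_weak_hopf_algebra = weak_hopf_algebra scale \<Delta> \<epsilon> S
  for scale :: "'k::field \<Rightarrow> 'h::{ring,monoid_mult} \<Rightarrow> 'h"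
    and \<Delta> :: "'h \<Rightarrow> ('h \<times> 'h) multiset set"
    and \<epsilon> :: "'h \<Rightarrow> 'k"
    and S :: "'h \<Rightarrow> 'h" +
  assumes bij_antipode: "bij S"
begin

section \<open>Tensors over the base algebra\<close>

abbreviation base :: "'h set" where
  "base \<equiv> range PL"

abbreviation EA :: "(('h \<times> 'h) multiset \<times> ('h \<times> 'h) multiset) set" where
  "EA \<equiv> A_tensor_eq base (\<lambda>a. a) PLbar"

abbreviation EA3 :: "(('h \<times> 'h \<times> 'h) multiset \<times> ('h \<times> 'h \<times> 'h) multiset) set" where
  "EA3 \<equiv> tensor3_eq base (\<lambda>h b. PLbar b * h) (\<lambda>a h. a * h)"

abbreviation proj :: "('h \<times> 'h) multiset set \<Rightarrow> ('h \<times> 'h) multiset set" where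
  "proj \<equiv> tensor_proj base (\<lambda>a. a) PLbar"

lemma base_PL: "a \<in> base \<Longrightarrow> PL a = a"
  by (auto simp: PL_PL)

lemma base_left_base: "a \<in> base \<Longrightarrow> a \<in> left_base"
  using PL_in by blast

lemma PL_scale_one: "PL (scale c 1) = scale c 1" and PLbar_scale_one: "PLbar (scale c 1) = scale c 1"
  using linD(2)[OF lin_PL[OF lin_id]] linD(2)[OF lin_PLbar[OF lin_id]] PL_one PLbar_one by simp_all

text \<open>A scalar \<open>c\<close> acts as the element \<open>scale c 1\<close> of the base,
  which \<open>PLbar\<close> fixes. The projection is well defined for this reason.\<close>

lemma k_relators_subset:
  "tensor_relators UNIV (\<lambda>x c. scale c x) scale \<subseteq> tensor_relators base (\<lambda>h b. PLbar b * h) (\<lambda>a h. a * h)"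
proof
  fix w assume w: "w \<in> tensor_relators UNIV (\<lambda>x c. scale c x) scale"
  obtain s t where "w = (s, t)" by (cases w)
  with w have "(s, t) \<in> tensor_relators UNIV (\<lambda>x c. scale c x) scale" by simp
  then have "(s, t) \<in> tensor_relators base (\<lambda>h b. PLbar b * h) (\<lambda>a h. a * h)"
  proof (cases rule: tensor_relators_cases)
    case (balance x c y)
    have "scale c 1 \<in> base" using PL_scale_one by (metis rangeI)
    from tensor_relators_intros(5)[OF this, of "\<lambda>h b. PLbar b * h" x y "\<lambda>a h. a * h"]
    show ?thesis by (simp add: balance PLbar_scale_one scale_mult_left)
  qed (simp_all add: tensor_relators_intros)
  then show "w \<in> tensor_relators base (\<lambda>h b. PLbar b * h) (\<lambda>a h. a * h)"
    using \<open>w = (s, t)\<close> by simp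
qed

lemmas k_eq_subset_EA = tensor_eq_mono[OF k_relators_subset]
lemmas k3_eq_subset_EA3 = tensor3_eq_mono[OF k_relators_subset]

lemma EA_class_eq_iff: "tensor_class EA s = tensor_class EA t \<longleftrightarrow> (s, t) \<in> EA"
  unfolding tensor_eq_def by (rule tensor_class_eq_iff)

lemma k_class_eq_iff:
  "tensor_class (k_tensor_eq scale) s = tensor_class (k_tensor_eq scale) t \<longleftrightarrow> (s, t) \<in> k_tensor_eq scale"
  unfolding tensor_eq_def by (rule tensor_class_eq_iff)

lemma EA_trans: "(s, t) \<in> EA \<Longrightarrow> (t, u) \<in> EA \<Longrightarrow> (s, u) \<in> EA"
  unfolding tensor_eq_def by (fact congruence_closure.trans)

lemma proj_class: "proj (tensor_class (k_tensor_eq scale) s) = tensor_class EA s"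
  unfolding tensor_proj_def using k_eq_subset_EA unfolding tensor_eq_def
  by (intro tensor_map_class) blast

lemma proj_comult: "proj (\<Delta> h) = tensor_class EA (rep h)"
  by (subst comult_eq_class) (rule proj_class)

lemma unit_absorbed_single: "((\<Sum>u\<in>#rep 1. image_mset (times2 u) {#(x, y)#}), {#(x, y)#}) \<in> EA"
proof -
  \<comment> \<open>The balancing relation moves values of \<open>PLbar\<close> at elements of the
    base, hence the form \<open>PLbar (PL u)\<close>, which equals \<open>PLbar u\<close>.\<close>
  let ?s = "image_mset (\<lambda>(u, v). (PLbar (PL u) * x, v * y)) (rep 1)"
  let ?t = "image_mset (\<lambda>(u, v). (x, PL u * (v * y))) (rep 1)"
  have "((\<Sum>u\<in>#rep 1. image_mset (times2 u) {#(x, y)#}), ?s) \<in> k_tensor_eq scale"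
  proof (rule k_tensor_eqI)
    fix \<phi> assume \<phi>: "bilin \<phi>"
    have "tsum (\<Sum>u\<in>#rep 1. image_mset (times2 u) {#(x, y)#}) \<phi> = sw 1 (\<lambda>u v. \<phi> (u * x) (v * y))"
      by (subst tsum_times2) (simp add: sw_def)
    also have "\<dots> = sw 1 (\<lambda>u v. \<phi> (PLbar u * x) (v * y))"
      by (rule sw_one_PLbar_left[symmetric]) (intro lin_intros bilin_left[OF \<phi>] bilin_right[OF \<phi>])
    also have "\<dots> = tsum ?s \<phi>"
      unfolding tsum_image_mset by (simp add: sw_def PLbar_PL)
    finally show "tsum (\<Sum>u\<in>#rep 1. image_mset (times2 u) {#(x, y)#}) \<phi> = tsum ?s \<phi>" .
  qed
  then have 1: "((\<Sum>u\<in>#rep 1. image_mset (times2 u) {#(x, y)#}), ?s) \<in> EA"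
    using k_eq_subset_EA by blast
  have "(\<Sum>w\<in>#rep 1. {#(PLbar (PL (fst w)) * x, snd w * y)#}, \<Sum>w\<in>#rep 1. {#(x, PL (fst w) * (snd w * y))#}) \<in> EA"
    unfolding tensor_eq_def
    by (rule congruence_closure_sum_mset) (rule tensor_relations(5)[unfolded tensor_eq_def], simp)
  then have 2: "(?s, ?t) \<in> EA"
    by (simp add: case_prod_unfold)
  have "(?t, {#(x, y)#}) \<in> k_tensor_eq scale"
  proof (rule k_tensor_eqI)
    fix \<phi> assume \<phi>: "bilin \<phi>"
    have "tsum ?t \<phi> = sw 1 (\<lambda>u v. \<phi> x (PL u * v * y))"
      unfolding tsum_image_mset by (simp add: sw_def mult.assoc)
    also have "\<dots> = \<phi> x (sw 1 (\<lambda>u v. PL u * v) * y)"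
      by (rule lin_sw_hom[symmetric]) (intro lin_intros bilin_right[OF \<phi>])
    finally show "tsum ?t \<phi> = tsum {#(x, y)#} \<phi>"
      by (simp add: sw_PL_left)
  qed
  then have 3: "(?t, {#(x, y)#}) \<in> EA"
    using k_eq_subset_EA by blast
  show ?thesis using 1 2 3 EA_trans by blast
qed

lemma EA_comult_one: "(rep 1, {#(1, 1)#}) \<in> EA"
proof -
  have "(\<Sum>u\<in>#s. image_mset (times2 u) {#(1, 1)#}) = s" for s :: "('h \<times> 'h) multiset"
    by (induction s) auto
  then show ?thesis using unit_absorbed_single[of 1 1] by simp
qed

lemma EA_tsum_unit:
  assumes "(s, t) \<in> EA" and \<phi>: "bilin \<phi>"
  shows "tsum s (\<lambda>x y. sw 1 (\<lambda>u v. \<phi> (u * x) (v * y))) = tsum t (\<lambda>x y. sw 1 (\<lambda>u v. \<phi> (u * x) (v * y)))"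
  using assms(1)
proof (rule tsum_balanced)
  note lin = lin_intros bilin_left[OF \<phi>] bilin_right[OF \<phi>]
  have \<psi>: "bilin (\<lambda>x y. sw 1 (\<lambda>u v. \<phi> (u * x) (v * y)))" by (intro lin)
  show "sw 1 (\<lambda>u v. \<phi> (u * (x + x')) (v * y))
      = sw 1 (\<lambda>u v. \<phi> (u * x) (v * y)) + sw 1 (\<lambda>u v. \<phi> (u * x') (v * y))" for x x' y
    using bilinD(1)[OF \<psi>] .
  show "sw 1 (\<lambda>u v. \<phi> (u * x) (v * (y + y')))
      = sw 1 (\<lambda>u v. \<phi> (u * x) (v * y)) + sw 1 (\<lambda>u v. \<phi> (u * x) (v * y'))" for x y y'
    using bilinD(2)[OF \<psi>] .
  fix x r y assume r: "r \<in> base"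
  have "sw 1 (\<lambda>u v. \<phi> (u * PLbar r * x) (v * y)) = sw 1 (\<lambda>u v. \<phi> (u * x) (v * PL r * y))"
    by (rule sw_one_balanced[where \<phi> = "\<lambda>u v. \<phi> (u * x) (v * y)"]) (intro lin)
  then show "sw 1 (\<lambda>u v. \<phi> (u * (PLbar r * x)) (v * y)) = sw 1 (\<lambda>u v. \<phi> (u * x) (v * (r * y)))"
    by (simp add: mult.assoc base_PL[OF r])
qed

text \<open>Formal sums that represent the elements of \<open>\<Delta>(1)(\<bbbH> \<otimes> \<bbbH>)\<Delta>(1)\<close>.\<close>

definition absorbing :: "('h \<times> 'h) multiset \<Rightarrow> bool" where
  "absorbing s \<longleftrightarrow> (\<forall>\<phi>. bilin \<phi> \<longrightarrow>
     tsum s (\<lambda>x y. sw 1 (\<lambda>u v. \<phi> (u * x) (v * y))) = tsum s \<phi> \<and>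
     tsum s (\<lambda>x y. sw 1 (\<lambda>u v. \<phi> (x * u) (y * v))) = tsum s \<phi>)"

lemma absorbingD:
  assumes "absorbing s" "bilin \<phi>"
  shows "tsum s (\<lambda>x y. sw 1 (\<lambda>u v. \<phi> (u * x) (v * y))) = tsum s \<phi>"
    "tsum s (\<lambda>x y. sw 1 (\<lambda>u v. \<phi> (x * u) (y * v))) = tsum s \<phi>"
  using assms by (simp_all add: absorbing_def)

lemma absorbing_EA_imp_k_eq:
  assumes "absorbing s" "absorbing t" "(s, t) \<in> EA"
  shows "(s, t) \<in> k_tensor_eq scale"
proof (rule k_tensor_eqI)
  fix \<phi> assume \<phi>: "bilin \<phi>"
  show "tsum s \<phi> = tsum t \<phi>"
    using EA_tsum_unit[OF assms(3) \<phi>] by (simp add: absorbingD[OF _ \<phi>] assms(1,2))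
qed

lemma absorbing_rep: "absorbing (rep h)"
  unfolding absorbing_def
proof (intro allI impI conjI)
  fix \<phi> assume \<phi>: "bilin \<phi>"
  have "sw h (\<lambda>x y. sw 1 (\<lambda>u v. \<phi> (u * x) (v * y))) = sw (1 * h) \<phi>"
    by (subst sw_swap) (rule sw_mult[OF \<phi>, symmetric])
  then show "tsum (rep h) (\<lambda>x y. sw 1 (\<lambda>u v. \<phi> (u * x) (v * y))) = tsum (rep h) \<phi>"
    by (simp add: sw_def)
  have "sw h (\<lambda>x y. sw 1 (\<lambda>u v. \<phi> (x * u) (y * v))) = sw (h * 1) \<phi>"
    by (rule sw_mult[OF \<phi>, symmetric])
  then show "tsum (rep h) (\<lambda>x y. sw 1 (\<lambda>u v. \<phi> (x * u) (y * v))) = tsum (rep h) \<phi>"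
    by (simp add: sw_def)
qed

lemma absorbing_empty: "absorbing {#}"
  by (simp add: absorbing_def)

lemma absorbing_plus: "absorbing s \<Longrightarrow> absorbing t \<Longrightarrow> absorbing (s + t)"
  by (simp add: absorbing_def)

lemma absorbing_scale:
  assumes "absorbing s"
  shows "absorbing (image_mset (\<lambda>(x, y). (scale c x, y)) s)"
  unfolding absorbing_def tsum_image_mset
proof (intro allI impI)
  fix \<phi> assume \<phi>: "bilin \<phi>"
  have "bilin (\<lambda>x y. \<phi> (scale c x) y)"
    by (intro lin_intros bilin_left[OF \<phi>] bilin_right[OF \<phi>])
  from absorbingD[OF assms this] show "tsum s (\<lambda>x y. sw 1 (\<lambda>u v. \<phi> (u * scale c x) (v * y))) = tsum s (\<lambda>x y. \<phi> (scale c x) y) \<and>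
      tsum s (\<lambda>x y. sw 1 (\<lambda>u v. \<phi> (scale c x * u) (y * v))) = tsum s (\<lambda>x y. \<phi> (scale c x) y)"
    by (simp add: scale_mult_left scale_mult_right)
qed

lemma absorbing_times:
  assumes "absorbing s" "absorbing t"
  shows "absorbing (\<Sum>u\<in>#s. image_mset (times2 u) t)"
  unfolding absorbing_def tsum_times2
proof (intro allI impI conjI)
  fix \<phi> assume \<phi>: "bilin \<phi>"
  note lin = lin_intros lin_tsum_arg bilin_left[OF \<phi>] bilin_right[OF \<phi>]
  have 1: "bilin (\<lambda>a b. tsum t (\<lambda>c d. \<phi> (a * c) (b * d)))" by (intro lin)
  have "tsum s (\<lambda>a b. tsum t (\<lambda>c d. sw 1 (\<lambda>u v. \<phi> (u * (a * c)) (v * (b * d)))))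
      = tsum s (\<lambda>a b. sw 1 (\<lambda>u v. tsum t (\<lambda>c d. \<phi> (u * a * c) (v * b * d))))"
    unfolding sw_def by (subst (2) tsum_swap) (simp add: mult.assoc)
  also have "\<dots> = tsum s (\<lambda>a b. tsum t (\<lambda>c d. \<phi> (a * c) (b * d)))"
    by (rule absorbingD(1)[OF assms(1) 1])
  finally show "tsum s (\<lambda>a b. tsum t (\<lambda>c d. sw 1 (\<lambda>u v. \<phi> (u * (a * c)) (v * (b * d)))))
      = tsum s (\<lambda>a b. tsum t (\<lambda>c d. \<phi> (a * c) (b * d)))" .
  have "bilin (\<lambda>c d. \<phi> (a * c) (b * d))" for a b by (intro lin)
  from absorbingD(2)[OF assms(2) this]
  show "tsum s (\<lambda>a b. tsum t (\<lambda>c d. sw 1 (\<lambda>u v. \<phi> (a * c * u) (b * d * v))))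
      = tsum s (\<lambda>a b. tsum t (\<lambda>c d. \<phi> (a * c) (b * d)))"
    by (simp add: mult.assoc)
qed

section \<open>The balancing subalgebra\<close>

abbreviation B :: "('h \<times> 'h) multiset set set" where
  "B \<equiv> {k_tensor_times scale (k_tensor_times scale (\<Delta> 1) X) (\<Delta> 1) | X.
      X \<in> tensor_space (k_tensor_eq scale)}"

lemma sandwich_class:
  "k_tensor_times scale (k_tensor_times scale (\<Delta> 1) (tensor_class (k_tensor_eq scale) s)) (\<Delta> 1)
    = tensor_class (k_tensor_eq scale)
        (\<Sum>u\<in>#(\<Sum>u\<in>#rep 1. image_mset (times2 u) s). image_mset (times2 u) (rep 1))"
  by (simp add: comult_eq_class k_tensor_times_class)

text \<open>\<open>\<Delta> 1\<close> is idempotent, by multiplicativity of the coproduct at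
  \<open>1 * 1\<close>, so a product enclosed by it absorbs a further copy on either side.\<close>

lemma B_memE:
  assumes "X \<in> B"
  obtains s where "X = tensor_class (k_tensor_eq scale) s" "absorbing s"
proof -
  from assms obtain Z where Z: "Z \<in> tensor_space (k_tensor_eq scale)"
    and X: "X = k_tensor_times scale (k_tensor_times scale (\<Delta> 1) Z) (\<Delta> 1)" by blast
  obtain z where z: "Z = tensor_class (k_tensor_eq scale) z"
    using tensor_space_cases[OF Z[unfolded tensor_eq_def]] by (auto simp: tensor_eq_def)
  let ?s = "\<Sum>u\<in>#(\<Sum>u\<in>#rep 1. image_mset (times2 u) z). image_mset (times2 u) (rep 1)"
  have "absorbing ?s"
    unfolding absorbing_def
  proof (intro allI impI)
    fix \<phi> assume \<phi>: "bilin \<phi>"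
    note lin = lin_intros lin_tsum_arg bilin_left[OF \<phi>] bilin_right[OF \<phi>]
    \<comment> \<open>Used with \<open>\<psi>\<close> the remaining sum over \<open>z\<close> and
      the right-hand copy of \<open>\<Delta> 1\<close>; the swaps below bring the two left-hand
      copies together first.\<close>
    have idem: "sw 1 (\<lambda>a b. sw 1 (\<lambda>u v. \<psi> (u * a) (v * b))) = sw 1 \<psi>" if "bilin \<psi>" for \<psi>
      using sw_mult[OF that, of 1 1] by (subst sw_swap) simp
    have "sw 1 (\<lambda>a b. tsum z (\<lambda>x y. sw 1 (\<lambda>c d. sw 1 (\<lambda>u v. \<phi> (u * (a * x * c)) (v * (b * y * d))))))
        = sw 1 (\<lambda>a b. tsum z (\<lambda>x y. sw 1 (\<lambda>c d. \<phi> (a * x * c) (b * y * d))))"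
      (is "?l = ?r")
    proof -
      have "?l = sw 1 (\<lambda>a b. tsum z (\<lambda>x y. sw 1 (\<lambda>u v. sw 1 (\<lambda>c d. \<phi> (u * a * x * c) (v * b * y * d)))))"
        by (subst (2) sw_swap) (simp add: mult.assoc)
      also have "\<dots> = sw 1 (\<lambda>a b. sw 1 (\<lambda>u v. tsum z (\<lambda>x y. sw 1 (\<lambda>c d. \<phi> (u * a * x * c) (v * b * y * d)))))"
        unfolding sw_def by (subst (2) tsum_swap) simp
      also have "\<dots> = ?r"
        by (rule idem[of "\<lambda>a b. tsum z (\<lambda>x y. sw 1 (\<lambda>c d. \<phi> (a * x * c) (b * y * d)))"])
          (intro lin)
      finally show "?l = ?r" .
    qed
    moreover have "sw 1 (\<lambda>c d. sw 1 (\<lambda>u v. \<phi> (p * c * u) (q * d * v))) = sw 1 (\<lambda>c d. \<phi> (p * c) (q * d))" for p q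
    proof -
      have "sw (1 * 1) (\<lambda>c d. \<phi> (p * c) (q * d)) = sw 1 (\<lambda>c d. sw 1 (\<lambda>u v. \<phi> (p * (c * u)) (q * (d * v))))"
        by (rule sw_mult) (intro lin)
      then show ?thesis by (simp add: mult.assoc)
    qed
    ultimately show "tsum ?s (\<lambda>x y. sw 1 (\<lambda>u v. \<phi> (u * x) (v * y))) = tsum ?s \<phi> \<and>
      tsum ?s (\<lambda>x y. sw 1 (\<lambda>u v. \<phi> (x * u) (y * v))) = tsum ?s \<phi>"
      unfolding tsum_times2 by (simp add: sw_def)
  qed
  then show ?thesis using that X unfolding z sandwich_class by blast
qed

lemma B_memI:
  assumes "absorbing s"
  shows "tensor_class (k_tensor_eq scale) s \<in> B"
proof -
  let ?s = "\<Sum>u\<in>#(\<Sum>u\<in>#rep 1. image_mset (times2 u) s). image_mset (times2 u) (rep 1)"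
  have "(?s, s) \<in> k_tensor_eq scale"
  proof (rule k_tensor_eqI)
    fix \<phi> assume \<phi>: "bilin \<phi>"
    note lin = lin_intros bilin_left[OF \<phi>] bilin_right[OF \<phi>]
    have 1: "bilin (\<lambda>x y. sw 1 (\<lambda>c d. \<phi> (x * c) (y * d)))" by (intro lin)
    have "tsum ?s \<phi> = tsum (rep 1) (\<lambda>a b. tsum s (\<lambda>x y. sw 1 (\<lambda>c d. \<phi> (a * x * c) (b * y * d))))"
      by (simp add: tsum_times2 sw_def)
    also have "\<dots> = tsum s (\<lambda>x y. sw 1 (\<lambda>a b. sw 1 (\<lambda>c d. \<phi> (a * x * c) (b * y * d))))"
      by (subst tsum_swap) (simp add: sw_def)
    also have "\<dots> = tsum s \<phi>"
      using absorbingD(1)[OF assms 1] absorbingD(2)[OF assms \<phi>] by simp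
    finally show "tsum ?s \<phi> = tsum s \<phi>" .
  qed
  then have "tensor_class (k_tensor_eq scale) ?s = tensor_class (k_tensor_eq scale) s"
    by (simp only: k_class_eq_iff)
  then have "tensor_class (k_tensor_eq scale) s
      = k_tensor_times scale (k_tensor_times scale (\<Delta> 1) (tensor_class (k_tensor_eq scale) s)) (\<Delta> 1)"
    by (simp only: sandwich_class)
  then show ?thesis
    using tensor_class_in_space by blast
qed

lemma B_subset: "B \<subseteq> tensor_space (k_tensor_eq scale)"
  by (rule subsetI, erule B_memE) (simp add: tensor_class_in_space)

lemma k_plus_class:
  "tensor_plus (k_tensor_eq scale) (tensor_class (k_tensor_eq scale) s) (tensor_class (k_tensor_eq scale) t)
    = tensor_class (k_tensor_eq scale) (s + t)"
  unfolding tensor_eq_def by (rule tensor_plus_class)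

lemma B_subalgebra: "tensor_subalgebra scale B"
  unfolding tensor_subalgebra_def tensor_subspace_def
proof (intro conjI ballI allI)
  show "B \<subseteq> tensor_space (k_tensor_eq scale)" by (rule B_subset)
  show "tensor_class (k_tensor_eq scale) {#} \<in> B" by (rule B_memI[OF absorbing_empty])
  show "tensor_scale (k_tensor_eq scale) scale c X \<in> B" if "X \<in> B" for c X
    using that by (rule B_memE) (simp only: tensor_scale_class B_memI[OF absorbing_scale])
  fix X Y assume "X \<in> B" "Y \<in> B"
  obtain s where X: "X = tensor_class (k_tensor_eq scale) s" "absorbing s"
    using \<open>X \<in> B\<close> by (rule B_memE)
  obtain t where Y: "Y = tensor_class (k_tensor_eq scale) t" "absorbing t"
    using \<open>Y \<in> B\<close> by (rule B_memE)
  show "tensor_plus (k_tensor_eq scale) X Y \<in> B"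
    unfolding X(1) Y(1) k_plus_class by (rule B_memI[OF absorbing_plus[OF X(2) Y(2)]])
  show "k_tensor_times scale X Y \<in> B"
    unfolding X(1) Y(1) k_tensor_times_class by (rule B_memI[OF absorbing_times[OF X(2) Y(2)]])
qed

text \<open>Injectivity makes \<open>\<Delta> h\<close> the only preimage in \<open>B\<close> of its
  projection, which is how it is used in \<open>comult_preimage\<close>.\<close>

lemma proj_inj_on_B: "X \<in> B \<Longrightarrow> Y \<in> B \<Longrightarrow> proj X = proj Y \<Longrightarrow> X = Y"
proof -
  assume "X \<in> B" "Y \<in> B" and eq: "proj X = proj Y"
  obtain s where X: "X = tensor_class (k_tensor_eq scale) s" "absorbing s"
    using \<open>X \<in> B\<close> by (rule B_memE)
  obtain t where Y: "Y = tensor_class (k_tensor_eq scale) t" "absorbing t"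
    using \<open>Y \<in> B\<close> by (rule B_memE)
  from eq have "(s, t) \<in> EA"
    unfolding X(1) Y(1) proj_class EA_class_eq_iff .
  with X(2) Y(2) have "(s, t) \<in> k_tensor_eq scale" by (rule absorbing_EA_imp_k_eq)
  then show "X = Y" unfolding X(1) Y(1) k_class_eq_iff .
qed

lemma comult_in_B: "\<Delta> h \<in> B"
  using B_memI[OF absorbing_rep] by (simp only: comult_eq_class[symmetric])

lemma kernel_B: "proj_kernel scale base (\<lambda>a. a) PLbar \<inter> B = {tensor_class (k_tensor_eq scale) {#}}"
proof -
  have 0: "tensor_class (k_tensor_eq scale) {#} \<in> B" by (rule B_memI[OF absorbing_empty])
  have "X = tensor_class (k_tensor_eq scale) {#}"
    if "X \<in> proj_kernel scale base (\<lambda>a. a) PLbar" "X \<in> B" for X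
    using that(1) by (intro proj_inj_on_B[OF that(2) 0]) (simp add: proj_kernel_def proj_class)
  with 0 show ?thesis
    by (auto simp del: mem_Collect_eq simp: proj_kernel_def proj_class tensor_class_in_space)
qed

text \<open>By \<open>kernel_B\<close> the intersection consists of the zero tensor, so only
  products with the empty sum have to be computed.\<close>

lemma kernel_ideal:
  "two_sided_ideal_in scale (proj_kernel scale base (\<lambda>a. a) PLbar \<inter> B) B"
  unfolding two_sided_ideal_in_def
proof (intro conjI)
  show "proj_kernel scale base (\<lambda>a. a) PLbar \<inter> B \<subseteq> B" by blast
  show "tensor_subspace scale (proj_kernel scale base (\<lambda>a. a) PLbar \<inter> B)"
    unfolding kernel_B tensor_subspace_def
    by (simp add: tensor_class_in_space k_plus_class tensor_scale_class)
  show "\<forall>X\<in>proj_kernel scale base (\<lambda>a. a) PLbar \<inter> B. \<forall>Y\<in>B.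
      k_tensor_times scale X Y \<in> proj_kernel scale base (\<lambda>a. a) PLbar \<inter> B \<and>
      k_tensor_times scale Y X \<in> proj_kernel scale base (\<lambda>a. a) PLbar \<inter> B"
    unfolding kernel_B
  proof (intro ballI)
    fix X Y assume X: "X \<in> {tensor_class (k_tensor_eq scale) {#}}" and "Y \<in> B"
    from \<open>Y \<in> B\<close> obtain t where Y: "Y = tensor_class (k_tensor_eq scale) t" by (rule B_memE)
    have "(\<Sum>u\<in>#t. {#}) = ({#} :: ('h \<times> 'h) multiset)" by (induction t) auto
    with X show "k_tensor_times scale X Y \<in> {tensor_class (k_tensor_eq scale) {#}} \<and>
        k_tensor_times scale Y X \<in> {tensor_class (k_tensor_eq scale) {#}}"
      by (simp add: Y k_tensor_times_class)
  qed
qed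

section \<open>The coproduct as a bimodule map\<close>

lemma EA_map:
  assumes "(s, t) \<in> EA"
    and "\<And>x y. f (x + y) = f x + f y" "\<And>r x. r \<in> base \<Longrightarrow> f (PLbar r * x) = PLbar r * f x"
    and "\<And>x y. g (x + y) = g x + g y" "\<And>r x. r \<in> base \<Longrightarrow> g (r * x) = r * g x"
  shows "(image_mset (\<lambda>(x, y). (f x, g y)) s, image_mset (\<lambda>(x, y). (f x, g y)) t) \<in> EA"
  using assms by (rule tensor_eq_map)

lemma EA_map_class:
  assumes "\<And>x y. f (x + y) = f x + f y" "\<And>r x. r \<in> base \<Longrightarrow> f (PLbar r * x) = PLbar r * f x"
    and "\<And>x y. g (x + y) = g x + g y" "\<And>r x. r \<in> base \<Longrightarrow> g (r * x) = r * g x"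
  shows "tensor_map EA (image_mset (\<lambda>(x, y). (f x, g y))) (tensor_class EA s)
    = tensor_class EA (image_mset (\<lambda>(x, y). (f x, g y)) s)"
  using EA_map[OF _ assms] unfolding tensor_eq_def by (rule tensor_map_class)

lemma rep_add: "(rep (x + y), rep x + rep y) \<in> k_tensor_eq scale"
  by (rule k_tensor_eqI) (simp add: sw_add sw_def[symmetric])

lemma rep_scale: "(rep (scale c x), image_mset (\<lambda>(x, y). (scale c x, y)) (rep x)) \<in> k_tensor_eq scale"
proof (rule k_tensor_eqI)
  fix \<phi> assume \<phi>: "bilin \<phi>"
  have "scale c (sw x \<phi>) = sw x (\<lambda>u v. \<phi> (scale c u) v)"
    by (simp add: sw_scale_arg bilinD[OF \<phi>])
  then show "tsum (rep (scale c x)) \<phi> = tsum (image_mset (\<lambda>(x, y). (scale c x, y)) (rep x)) \<phi>"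
    unfolding tsum_image_mset by (simp add: sw_scale[OF \<phi>] sw_def[symmetric])
qed

text \<open>The left base multiplies the first leg and the right base the second, so bilinearity of
  the coproduct over the base holds already before projection.\<close>

lemma rep_bimodule:
  assumes "a \<in> left_base"
  shows "(rep (PLbar b * (a * h)), image_mset (\<lambda>(x, y). (a * x, PLbar b * y)) (rep h)) \<in> k_tensor_eq scale"
proof (rule k_tensor_eqI)
  fix \<phi> assume \<phi>: "bilin \<phi>"
  note lin = lin_intros bilin_left[OF \<phi>] bilin_right[OF \<phi>]
  have "sw (PLbar b * (a * h)) \<phi> = sw (a * h) (\<lambda>u v. \<phi> u (PLbar b * v))"
    by (rule sw_right_base[OF PLbar_in \<phi>])
  also have "\<dots> = sw h (\<lambda>u v. \<phi> (a * u) (PLbar b * v))"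
    by (rule sw_left_base(1)[OF assms]) (intro lin)
  finally show "tsum (rep (PLbar b * (a * h))) \<phi>
      = tsum (image_mset (\<lambda>(x, y). (a * x, PLbar b * y)) (rep h)) \<phi>"
    unfolding tsum_image_mset by (simp add: sw_def)
qed

lemma k_imp_EA_class: "(s, t) \<in> k_tensor_eq scale \<Longrightarrow> tensor_class EA s = tensor_class EA t"
  unfolding EA_class_eq_iff using k_eq_subset_EA by blast

lemma proj_comult_linear: "tensor_linear EA scale (\<lambda>h. proj (\<Delta> h))"
  unfolding tensor_linear_def proj_comult
proof (intro conjI allI)
  show "tensor_class EA (rep x) \<in> tensor_space EA" for x
    by (rule tensor_class_in_space)
  show "tensor_class EA (rep (x + y)) = tensor_plus EA (tensor_class EA (rep x)) (tensor_class EA (rep y))" for x y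
    using k_imp_EA_class[OF rep_add] unfolding tensor_eq_def by (simp add: tensor_plus_class)
  show "tensor_class EA (rep (scale c x)) = tensor_scale EA scale c (tensor_class EA (rep x))" for c x
    unfolding tensor_scale_def k_imp_EA_class[OF rep_scale]
    by (rule EA_map_class[symmetric]) (simp_all add: scale_right_distrib scale_mult_right)
qed

lemma base_commute: "a \<in> base \<Longrightarrow> a * (PLbar b * x) = PLbar b * (a * x)"
  by (simp add: mult.assoc[symmetric] left_right_base_commute[OF base_left_base PLbar_in])

lemma proj_comult_bimodule:
  assumes a: "a \<in> base"
  shows "proj (\<Delta> (PLbar b * (a * h)))
    = tensor_map EA (image_mset (\<lambda>(x, y). (a * x, PLbar b * y))) (proj (\<Delta> h))"
  unfolding proj_comult k_imp_EA_class[OF rep_bimodule[OF base_left_base[OF a]]]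
  by (rule EA_map_class[symmetric]) (simp_all add: distrib_left base_commute a)

section \<open>Coassociativity over the base\<close>

lemma EA3_trans: "(s, t) \<in> EA3 \<Longrightarrow> (t, u) \<in> EA3 \<Longrightarrow> (s, u) \<in> EA3"
  and EA3_sym: "(s, t) \<in> EA3 \<Longrightarrow> (t, s) \<in> EA3"
  unfolding tensor3_eq_def by (fact congruence_closure.trans, fact congruence_closure.sym)

lemma EA3_sum_mset:
  "(\<And>w. w \<in># m \<Longrightarrow> (f w, g w) \<in> EA3) \<Longrightarrow> ((\<Sum>w\<in>#m. f w), (\<Sum>w\<in>#m. g w)) \<in> EA3"
  unfolding tensor3_eq_def by (rule congruence_closure_sum_mset)

lemma EA_left_relations:
  "(rep (x + x'), rep x + rep x') \<in> EA" "(rep 0, {#}) \<in> EA"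
  "(rep (PLbar b * x), image_mset (\<lambda>(u, v). (u, PLbar b * v)) (rep x)) \<in> EA"
  "a \<in> base \<Longrightarrow> (rep (a * x), image_mset (\<lambda>(u, v). (a * u, v)) (rep x)) \<in> EA"
proof -
  show "(rep (x + x'), rep x + rep x') \<in> EA" using rep_add k_eq_subset_EA by blast
  have "(rep 0, {#}) \<in> k_tensor_eq scale"
    by (rule k_tensor_eqI) (use linD(3)[OF lin_sw[OF _ lin_id]] in \<open>simp add: sw_def\<close>)
  then show "(rep 0, {#}) \<in> EA" using k_eq_subset_EA by blast
  have 1: "1 \<in> left_base" using PL_in[of 1] by (simp add: PL_one)
  show "(rep (PLbar b * x), image_mset (\<lambda>(u, v). (u, PLbar b * v)) (rep x)) \<in> EA"
    using rep_bimodule[OF 1, of b x] k_eq_subset_EA by auto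
  show "(rep (a * x), image_mset (\<lambda>(u, v). (a * u, v)) (rep x)) \<in> EA" if "a \<in> base"
    using rep_bimodule[OF base_left_base[OF that], of 1 x] k_eq_subset_EA by (auto simp: PLbar_one)
qed


lemma EA3_image:
  assumes "\<And>u v. ({#f u v#}, g u v) \<in> EA3"
  shows "(image_mset (\<lambda>(u, v). f u v) m, \<Sum>(u, v)\<in>#m. g u v) \<in> EA3"
proof -
  have "((\<Sum>w\<in>#m. {#f (fst w) (snd w)#}), \<Sum>w\<in>#m. g (fst w) (snd w)) \<in> EA3"
    using assms by (rule EA3_sum_mset)
  then show ?thesis by (simp add: case_prod_unfold)
qed

text \<open>The formal sum under the union in \<open>comult_left\<close>, named so that its
  additivity in \<open>t\<close> is available to \<open>congruence_closure_map\<close>.\<close>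

definition comult_left_sum ::
    "('h \<Rightarrow> ('h \<times> 'h) multiset) \<Rightarrow> ('h \<times> 'h) multiset \<Rightarrow> ('h \<times> 'h \<times> 'h) multiset" where
  "comult_left_sum d t = (\<Sum>(x, y)\<in>#t. image_mset (\<lambda>(u, v). (u, v, y)) (d x))"

definition comult_right_sum ::
    "('h \<Rightarrow> ('h \<times> 'h) multiset) \<Rightarrow> ('h \<times> 'h) multiset \<Rightarrow> ('h \<times> 'h \<times> 'h) multiset" where
  "comult_right_sum d t = (\<Sum>(x, y)\<in>#t. image_mset (\<lambda>(u, v). (x, u, v)) (d y))"

lemma comult_sum_simps:
  "comult_left_sum d {#} = {#}" "comult_right_sum d {#} = {#}"
  "comult_left_sum d (add_mset (x, y) t) = image_mset (\<lambda>(u, v). (u, v, y)) (d x) + comult_left_sum d t"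
  "comult_right_sum d (add_mset (x, y) t) = image_mset (\<lambda>(u, v). (x, u, v)) (d y) + comult_right_sum d t"
  "comult_left_sum d (s + t) = comult_left_sum d s + comult_left_sum d t"
  "comult_right_sum d (s + t) = comult_right_sum d s + comult_right_sum d t"
  by (simp_all add: comult_left_sum_def comult_right_sum_def)

lemma sum_two_images:
  "(\<Sum>(u, v)\<in>#m. {#f u v, g u v#}) = image_mset (\<lambda>(u, v). f u v) m + image_mset (\<lambda>(u, v). g u v) m"
  by (induction m) auto

lemma sum_single_image: "(\<Sum>(u, v)\<in>#m. {#f u v#}) = image_mset (\<lambda>(u, v). f u v) m"
  by (induction m) auto

text \<open>The essential case is balancing: \<open>\<Delta>(\<beta>(r) x) = (1 \<otimes>
  \<beta>(r)) \<Delta>(x)\<close> keeps \<open>\<beta>(r)\<close> in the second factor, from where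
  it crosses into the third.\<close>

lemma comult_left_sum_respects:
  assumes "(s, t) \<in> EA"
  shows "(comult_left_sum rep s, comult_left_sum rep t) \<in> EA3"
  using assms unfolding tensor_eq_def tensor3_eq_def
proof (rule congruence_closure_map, fold tensor3_eq_def)
  fix s t assume "(s, t) \<in> tensor_relators base (\<lambda>h b. PLbar b * h) (\<lambda>a h. a * h)"
  then show "(comult_left_sum rep s, comult_left_sum rep t) \<in> EA3"
  proof (cases rule: tensor_relators_cases)
    case (add_left x x' y)
    then show ?thesis
      using tensor3_left[OF EA_left_relations(1)[of x x'], of y] by (simp add: comult_sum_simps)
  next
    case (add_right x y y')
    have "(image_mset (\<lambda>(u, v). (u, v, y + y')) (rep x), \<Sum>(u, v)\<in>#rep x. {#(u, v, y), (u, v, y')#}) \<in> EA3"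
      by (rule EA3_image) (rule tensor3_relations(2))
    then show ?thesis
      by (simp add: add_right comult_sum_simps sum_two_images)
  next
    case (zero_left y)
    then show ?thesis
      using tensor3_left[OF EA_left_relations(2), of y] by (simp add: comult_sum_simps)
  next
    case (zero_right x)
    have "(image_mset (\<lambda>(u, v). (u, v, 0)) (rep x), \<Sum>(u, v)\<in>#rep x. {#}) \<in> EA3"
      by (rule EA3_image) (rule tensor3_relations(4))
    then show ?thesis
      by (simp add: zero_right comult_sum_simps case_prod_unfold)
  next
    case (balance x r y)
    have "(image_mset (\<lambda>(u, v). (u, v, y)) (rep (PLbar r * x)), image_mset (\<lambda>(u, v). (u, PLbar r * v, y)) (rep x)) \<in> EA3"
      using tensor3_left[OF EA_left_relations(3)[of r x], of y]
      by (simp add: multiset.map_comp comp_def case_prod_unfold)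
    moreover have "(image_mset (\<lambda>(u, v). (u, PLbar r * v, y)) (rep x), \<Sum>(u, v)\<in>#rep x. {#(u, v, r * y)#}) \<in> EA3"
      by (rule EA3_image) (rule tensor3_relations(6)[OF balance(1)])
    ultimately have "(image_mset (\<lambda>(u, v). (u, v, y)) (rep (PLbar r * x)), \<Sum>(u, v)\<in>#rep x. {#(u, v, r * y)#}) \<in> EA3"
      by (rule EA3_trans)
    then show ?thesis
      by (simp add: balance(2,3) comult_sum_simps case_prod_unfold)
  qed
qed (simp add: comult_sum_simps)

text \<open>The mirror image: \<open>\<Delta>(r y) = (r \<otimes> 1) \<Delta>(y)\<close> keeps
  \<open>r\<close> in the second factor, and the crossing takes place between the first two.\<close>

lemma comult_right_sum_respects:
  assumes "(s, t) \<in> EA"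
  shows "(comult_right_sum rep s, comult_right_sum rep t) \<in> EA3"
  using assms unfolding tensor_eq_def tensor3_eq_def
proof (rule congruence_closure_map, fold tensor3_eq_def)
  fix s t assume "(s, t) \<in> tensor_relators base (\<lambda>h b. PLbar b * h) (\<lambda>a h. a * h)"
  then show "(comult_right_sum rep s, comult_right_sum rep t) \<in> EA3"
  proof (cases rule: tensor_relators_cases)
    case (add_left x x' y)
    have "(image_mset (\<lambda>(u, v). (x + x', u, v)) (rep y), \<Sum>(u, v)\<in>#rep y. {#(x, u, v), (x', u, v)#}) \<in> EA3"
      by (rule EA3_image) (rule tensor3_relations(1))
    then show ?thesis
      by (simp add: add_left comult_sum_simps sum_two_images)
  next
    case (add_right x y y')
    then show ?thesis
      using tensor3_right[OF EA_left_relations(1)[of y y'], of x] by (simp add: comult_sum_simps)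
  next
    case (zero_left y)
    have "(image_mset (\<lambda>(u, v). (0, u, v)) (rep y), \<Sum>(u, v)\<in>#rep y. {#}) \<in> EA3"
      by (rule EA3_image) (rule tensor3_relations(3))
    then show ?thesis
      by (simp add: zero_left comult_sum_simps case_prod_unfold)
  next
    case (zero_right x)
    then show ?thesis
      using tensor3_right[OF EA_left_relations(2), of x] by (simp add: comult_sum_simps)
  next
    case (balance x r y)
    have 1: "(image_mset (\<lambda>(u, v). (PLbar r * x, u, v)) (rep y), \<Sum>(u, v)\<in>#rep y. {#(x, r * u, v)#}) \<in> EA3"
      by (rule EA3_image) (rule tensor3_relations(5)[OF balance(1)])
    have 2: "(image_mset (\<lambda>(u, v). (x, u, v)) (rep (r * y)), image_mset (\<lambda>(u, v). (x, r * u, v)) (rep y)) \<in> EA3"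
      using tensor3_right[OF EA_left_relations(4)[OF balance(1), of y], of x]
      by (simp add: multiset.map_comp comp_def case_prod_unfold)
    show ?thesis
      using EA3_trans[OF 1[unfolded sum_single_image] EA3_sym[OF 2]] by (simp add: balance(2,3) comult_sum_simps)
  qed
qed (simp add: comult_sum_simps)

lemma comult_sum_cong:
  assumes "(s, t) \<in> EA" and d: "\<And>x. (rep x, d x) \<in> EA"
  shows "(comult_left_sum rep s, comult_left_sum d t) \<in> EA3"
    "(comult_right_sum rep s, comult_right_sum d t) \<in> EA3"
proof -
  have "(comult_left_sum rep t, comult_left_sum d t) \<in> EA3"
    unfolding comult_left_sum_def case_prod_unfold
    by (rule EA3_sum_mset) (rule tensor3_left[OF d, unfolded case_prod_unfold])
  with comult_left_sum_respects[OF assms(1)] show "(comult_left_sum rep s, comult_left_sum d t) \<in> EA3"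
    by (rule EA3_trans)
  have "(comult_right_sum rep t, comult_right_sum d t) \<in> EA3"
    unfolding comult_right_sum_def case_prod_unfold
    by (rule EA3_sum_mset) (rule tensor3_right[OF d, unfolded case_prod_unfold])
  with comult_right_sum_respects[OF assms(1)] show "(comult_right_sum rep s, comult_right_sum d t) \<in> EA3"
    by (rule EA3_trans)
qed

lemma in_EA_class_iff: "t \<in> tensor_class EA s \<longleftrightarrow> (s, t) \<in> EA"
  unfolding tensor_eq_def by (rule in_tensor_class_iff)

lemma EA_refl: "(s, s) \<in> EA"
  unfolding tensor_eq_def by (rule congruence_closure.refl)

lemma EA3_class_eqI: "(s, t) \<in> EA3 \<Longrightarrow> tensor_class EA3 t = tensor_class EA3 s"
  unfolding tensor3_eq_def tensor_class_eq_iff by (rule congruence_closure.sym)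

text \<open>The union runs over all representatives and all choices \<open>d\<close>;
  \<open>comult_sum_cong\<close> gives each of them the same class.\<close>

lemma comult_EA3_class:
  "comult_left EA3 (\<lambda>x. tensor_class EA (rep x)) (tensor_class EA s) = tensor_class EA3 (comult_left_sum rep s)"
  "comult_right EA3 (\<lambda>x. tensor_class EA (rep x)) (tensor_class EA s) = tensor_class EA3 (comult_right_sum rep s)"
proof -
  have s: "s \<in> tensor_class EA s" and r: "rep \<in> {d. \<forall>x. d x \<in> tensor_class EA (rep x)}"
    by (simp_all add: in_EA_class_iff EA_refl)
  have "(\<Union>d\<in>{d. \<forall>x. d x \<in> tensor_class EA (rep x)}. tensor_class EA3 (comult_left_sum d t))
      = tensor_class EA3 (comult_left_sum rep s)"
    and "(\<Union>d\<in>{d. \<forall>x. d x \<in> tensor_class EA (rep x)}. tensor_class EA3 (comult_right_sum d t))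
      = tensor_class EA3 (comult_right_sum rep s)" if t: "t \<in> tensor_class EA s" for t
  proof -
    have eqs: "tensor_class EA3 (comult_left_sum d t) = tensor_class EA3 (comult_left_sum rep s)"
      "tensor_class EA3 (comult_right_sum d t) = tensor_class EA3 (comult_right_sum rep s)"
      if "d \<in> {d. \<forall>x. d x \<in> tensor_class EA (rep x)}" for d
    proof -
      have d: "(rep x, d x) \<in> EA" for x
        using that in_EA_class_iff by blast
      note cong = comult_sum_cong[OF t[unfolded in_EA_class_iff] d]
      show "tensor_class EA3 (comult_left_sum d t) = tensor_class EA3 (comult_left_sum rep s)"
        by (rule EA3_class_eqI[OF cong(1)])
      show "tensor_class EA3 (comult_right_sum d t) = tensor_class EA3 (comult_right_sum rep s)"
        by (rule EA3_class_eqI[OF cong(2)])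
    qed
    show "(\<Union>d\<in>{d. \<forall>x. d x \<in> tensor_class EA (rep x)}. tensor_class EA3 (comult_left_sum d t))
      = tensor_class EA3 (comult_left_sum rep s)"
      by (rule UN_constant_eq[OF r], rule ballI, rule eqs(1))
    show "(\<Union>d\<in>{d. \<forall>x. d x \<in> tensor_class EA (rep x)}. tensor_class EA3 (comult_right_sum d t))
      = tensor_class EA3 (comult_right_sum rep s)"
      by (rule UN_constant_eq[OF r], rule ballI, rule eqs(2))
  qed
  note eqs = this
  show "comult_left EA3 (\<lambda>x. tensor_class EA (rep x)) (tensor_class EA s) = tensor_class EA3 (comult_left_sum rep s)"
    unfolding comult_left_def comult_left_sum_def[symmetric] by (rule UN_constant_eq[OF s], rule ballI, rule eqs(1))
  show "comult_right EA3 (\<lambda>x. tensor_class EA (rep x)) (tensor_class EA s) = tensor_class EA3 (comult_right_sum rep s)"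
    unfolding comult_right_def comult_right_sum_def[symmetric] by (rule UN_constant_eq[OF s], rule ballI, rule eqs(2))
qed

text \<open>Over the field \<open>rep_left h\<close> represents both bracketings. Enlarging the
  relations carries this to the base, where \<open>comult_sum_cong\<close> replaces the unknown
  representatives \<open>t\<close> and \<open>d\<close> by \<open>rep\<close>.\<close>

lemma proj_coassoc:
  "comult_left EA3 (\<lambda>x. proj (\<Delta> x)) (proj (\<Delta> h)) = comult_right EA3 (\<lambda>x. proj (\<Delta> x)) (proj (\<Delta> h))"
proof -
  have "rep_left h \<in> comult_right (k_tensor3_eq scale) \<Delta> (\<Delta> h)"
    using rep_left_in[of h] by (simp only: coassoc)
  then obtain t d where t: "t \<in> \<Delta> h" and d: "\<And>x. d x \<in> \<Delta> x"
    and eq: "(comult_right_sum d t, rep_left h) \<in> k_tensor3_eq scale"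
    unfolding comult_right_def comult_right_sum_def[symmetric] tensor3_eq_def
    by (auto simp: in_tensor_class_iff)
  have "(rep h, t) \<in> EA" "(rep x, d x) \<in> EA" for x
    by (rule subsetD[OF k_eq_subset_EA], rule t[unfolded in_comult_iff] d[unfolded in_comult_iff])+
  then have "(comult_right_sum rep (rep h), comult_right_sum d t) \<in> EA3"
    by (rule comult_sum_cong)
  moreover have "(comult_right_sum d t, comult_left_sum rep (rep h)) \<in> EA3"
    using subsetD[OF k3_eq_subset_EA3 eq] unfolding rep_left_def comult_left_sum_def .
  ultimately have "(comult_right_sum rep (rep h), comult_left_sum rep (rep h)) \<in> EA3"
    by (rule EA3_trans)
  then show ?thesis
    unfolding proj_comult comult_EA3_class by (rule EA3_class_eqI)
qed


section \<open>Counit and antipode over the base\<close>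

lemma inj_antipode: "inj S" and surj_antipode: "surj S"
  using bij_antipode by (simp_all add: bij_def)

lemma PLbar_mult_base: "a \<in> base \<Longrightarrow> b \<in> base \<Longrightarrow> PLbar (a * b) = PLbar b * PLbar a"
  by (rule PLbar_mult[OF inj_antipode]; rule base_PL[symmetric])

lemma base_mult: "a \<in> base \<Longrightarrow> PL (a * h) = a * PL h"
  by (rule PL_left_base_mult[OF base_left_base])

lemma PL_bimodule: "a \<in> base \<Longrightarrow> b \<in> base \<Longrightarrow> PL (PLbar b * (a * h)) = a * PL h * b"
  unfolding PL_right_base_mult[OF PLbar_in] antipode_PLbar by (simp only: base_PL base_mult)

text \<open>Balancing holds since \<open>PL (PLbar r * x) = PL x * r\<close>; the value is then the
  identity \<open>sw_PL_left\<close> over the field.\<close>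

lemma proj_counit_left: "tensor_lift (\<lambda>(h1, h2). PL h1 * h2) (proj (\<Delta> h)) = h"
proof -
  have "tensor_lift (\<lambda>(h1, h2). PL h1 * h2) (proj (\<Delta> h)) = tsum (rep h) (\<lambda>u v. PL u * v)"
    unfolding proj_comult
  proof (rule tensor_lift_balanced)
    show "PL (x + x') * y = PL x * y + PL x' * y" for x x' y
      by (simp add: linD(1)[OF lin_PL[OF lin_id]] distrib_right)
    show "PL (PLbar r * x) * y = PL x * (r * y)" if "r \<in> base" for x r y
      unfolding PL_right_base_mult[OF PLbar_in] antipode_PLbar base_PL[OF that] by (rule mult.assoc)
  qed (simp add: distrib_left)
  then show ?thesis by (simp add: sw_def[symmetric] sw_PL_left)
qed

text \<open>Balancing rests on the reversal of products by \<open>PLbar\<close> on the base, and so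
  on injectivity of \<open>S\<close>.\<close>

lemma proj_counit_right: "tensor_lift (\<lambda>(h1, h2). PLbar (PL h2) * h1) (proj (\<Delta> h)) = h"
proof -
  have "tensor_lift (\<lambda>(h1, h2). PLbar (PL h2) * h1) (proj (\<Delta> h)) = tsum (rep h) (\<lambda>u v. PLbar (PL v) * u)"
    unfolding proj_comult
  proof (rule tensor_lift_balanced)
    show "PLbar (PL (y + y')) * x = PLbar (PL y) * x + PLbar (PL y') * x" for x y y'
      by (simp add: linD(1)[OF lin_PLbar[OF lin_PL[OF lin_id]]] distrib_right)
    show "PLbar (PL y) * (PLbar r * x) = PLbar (PL (r * y)) * x" if "r \<in> base" for x r y
      unfolding base_mult[OF that] PLbar_mult_base[OF that rangeI] by (rule mult.assoc[symmetric])
  qed (simp add: distrib_left)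
  then show ?thesis by (simp add: PLbar_PL sw_def[symmetric] sw_PLbar_right)
qed

text \<open>Antimultiplicativity together with \<open>S (PLbar r) = r\<close> gives balancing; the
  value on \<open>rep h\<close> is \<open>PR h\<close>.\<close>

lemma proj_antipode_left: "tensor_lift (\<lambda>(x, y). S x * y) (proj (\<Delta> h)) = PLbar (PL (S h))"
proof -
  have "tensor_lift (\<lambda>(x, y). S x * y) (proj (\<Delta> h)) = tsum (rep h) (\<lambda>u v. S u * v)"
    unfolding proj_comult
  proof (rule tensor_lift_balanced)
    show "S (x + x') * y = S x * y + S x' * y" for x x' y
      by (simp add: linD(1)[OF antipode_linear] distrib_right)
    show "S (PLbar r * x) * y = S x * (r * y)" if "r \<in> base" for x r y
      unfolding antipode_mult antipode_PLbar base_PL[OF that] by (rule mult.assoc)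
  qed (simp add: distrib_left)
  then show ?thesis by (simp add: sw_def[symmetric] sw_antipode_left PR_eq_PLbar[OF inj_antipode])
qed

lemma antipode_lift_class:
  "tensor_lift (\<lambda>(x, y). x * S y) (tensor_class (k_tensor_eq scale) s) = tsum s (\<lambda>x y. x * S y)"
  by (rule tensor_lift_balanced)
    (simp_all add: linD[OF antipode_linear] distrib_left distrib_right scale_mult_left scale_mult_right)

lemma comult_preimage: "X \<in> B \<Longrightarrow> proj X = proj (\<Delta> h) \<Longrightarrow> X = \<Delta> h"
  by (rule proj_inj_on_B[OF _ comult_in_B])

theorem hopf_algebroid:
  "balanced_hopf_algebroid scale base scale (\<lambda>a. a) PLbar (\<lambda>h. proj (\<Delta> h)) PL B S"
proof unfold_locales
  show "subspace base"
  proof (rule subspaceI)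
    show "0 \<in> base"
      using linD(3)[OF lin_PL[OF lin_id]] by (metis rangeI)
    \<comment> \<open>Elements of the base are fixed by \<open>PL\<close>, so a sum of two of them
      is its own image under \<open>PL\<close>; multiples and products are treated alike.\<close>
    show "x + y \<in> base" if "x \<in> base" "y \<in> base" for x y
      using linD(1)[OF lin_PL[OF lin_id], of x y] base_PL[OF that(1)] base_PL[OF that(2)] by (metis rangeI)
    show "scale c x \<in> base" if "x \<in> base" for c x
      using linD(2)[OF lin_PL[OF lin_id], of c x] base_PL[OF that] by (metis rangeI)
  qed
  show "1 \<in> base"
    using PL_one by (metis rangeI)
  show "a * b \<in> base" if "a \<in> base" "b \<in> base" for a b
    using base_mult[OF that(1), of b] base_PL[OF that(2)] by (metis rangeI)
  show "PLbar 1 = 1" by (rule PLbar_one)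
  show add: "PLbar (a + b) = PLbar a + PLbar b" for a b
    by (rule linD(1)[OF lin_PLbar[OF lin_id]])
  show scale: "PLbar (scale c a) = scale c (PLbar a)" for a c
    by (rule linD(2)[OF lin_PLbar[OF lin_id]])
  show "PLbar (a * b) = PLbar b * PLbar a" if "a \<in> base" "b \<in> base" for a b
    using that by (rule PLbar_mult_base)
  show "a * PLbar b = PLbar b * a" if "a \<in> base" for a b
    using left_right_base_commute[OF base_left_base[OF that] PLbar_in] .
  show "a * (x + y) = a * x + a * y" "PLbar b * (x + y) = PLbar b * x + PLbar b * y" for a b x y
    by (simp_all only: distrib_left)
  show "a * scale c x = scale c (a * x)" "PLbar b * scale c x = scale c (PLbar b * x)" for a b c x
    by (simp_all only: scale_mult_right)
  show "(a + b) * h = a * h + b * h" for a b h :: 'h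
    by (rule distrib_right)
  show "scale c a * h = scale c (a * h)" for a h c
    by (rule scale_mult_left)
  show "1 * h = h" "(a * b) * h = a * (b * h)" for a b h :: 'h
    by (simp_all add: mult.assoc)
  show "PLbar (a + b) * h = PLbar a * h + PLbar b * h" for a b h
    by (simp only: add distrib_right)
  show "PLbar (scale c a) * h = scale c (PLbar a * h)" for a h c
    by (simp only: scale scale_mult_left)
  show "PLbar 1 * h = h" for h
    by (simp add: PLbar_one)
  show "PLbar (a * b) * h = PLbar b * (PLbar a * h)" if "a \<in> base" "b \<in> base" for a b h
    by (simp only: PLbar_mult_base[OF that] mult.assoc)
  show "PLbar b * (a * h) = a * (PLbar b * h)" if "a \<in> base" for a b h
    by (rule base_commute[OF that, symmetric])
  show "tensor_linear EA scale (\<lambda>h. proj (\<Delta> h))"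
    by (rule proj_comult_linear)
  show "proj (\<Delta> (PLbar b * (a * h)))
      = tensor_map EA (image_mset (\<lambda>(x, y). (a * x, PLbar b * y))) (proj (\<Delta> h))" if "a \<in> base" for a b h
    using that by (rule proj_comult_bimodule)
  show "comult_left EA3 (\<lambda>x. proj (\<Delta> x)) (proj (\<Delta> h)) = comult_right EA3 (\<lambda>x. proj (\<Delta> x)) (proj (\<Delta> h))" for h
    by (rule proj_coassoc)
  show "PL h \<in> base" for h by (rule rangeI)
  show "PL (x + y) = PL x + PL y" "PL (scale c x) = scale c (PL x)" for x y c
    by (rule linD[OF lin_PL[OF lin_id]])+
  show "PL (PLbar b * (a * h)) = a * PL h * b" if "a \<in> base" "b \<in> base" for a b h
    using that by (rule PL_bimodule)
  show "tensor_lift (\<lambda>(h1, h2). PL h1 * h2) (proj (\<Delta> h)) = h" for h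
    by (rule proj_counit_left)
  show "tensor_lift (\<lambda>(h1, h2). PLbar (PL h2) * h1) (proj (\<Delta> h)) = h" for h
    by (rule proj_counit_right)
  show "tensor_subalgebra scale B"
    by (rule B_subalgebra)
  show "algebra_action scale scale base (\<lambda>h a. PL (h * a))"
    unfolding algebra_action_def
    by (auto simp: linD[OF lin_PL[OF lin_id]] distrib_left distrib_right scale_mult_left scale_mult_right
        PL_mult_PL PL_PL mult.assoc)
  show "two_sided_ideal_in scale (proj_kernel scale base (\<lambda>a. a) PLbar \<inter> B) B"
    by (rule kernel_ideal)
  show "proj (\<Delta> h) \<in> proj ` B" for h
    using comult_in_B by (rule imageI)
  \<comment> \<open>\<open>X\<close> and \<open>Y\<close> are forced to be \<open>\<Delta> h\<close>
    and \<open>\<Delta> h'\<close>, so multiplicativity over the field suffices.\<close>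
  show "proj (\<Delta> (h * h')) = proj (k_tensor_times scale X Y)"
    if "X \<in> B" "Y \<in> B" "proj X = proj (\<Delta> h)" "proj Y = proj (\<Delta> h')" for X Y h h'
    using comult_preimage[OF that(1,3)] comult_preimage[OF that(2,4)] comult_mult[of h h'] by simp
  show "proj (\<Delta> 1) = tensor_class EA {#(1, 1)#}"
    unfolding proj_comult EA_class_eq_iff by (rule EA_comult_one)
  show "S (x + y) = S x + S y" "S (scale c x) = scale c (S x)" for x y c
    by (rule linD[OF antipode_linear])+
  show "S (x * y) = S y * S x" for x y by (rule antipode_mult)
  show "S 1 = 1" by (rule antipode_one[OF surj_antipode])
  show "tensor_lift (\<lambda>(x, y). x * S y) X = 0" if "X \<in> proj_kernel scale base (\<lambda>a. a) PLbar \<inter> B" for X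
    using that unfolding kernel_B by (simp add: antipode_lift_class)
  show "S (PLbar a) = a" if "a \<in> base" for a
    using that by (simp only: antipode_PLbar base_PL)
  show "tensor_lift (\<lambda>(x, y). x * S y) X = PL h" if "X \<in> B" "proj X = proj (\<Delta> h)" for X h
    unfolding comult_preimage[OF that]
    by (subst comult_eq_class) (simp only: antipode_lift_class sw_def[symmetric] sw_antipode_right)
  show "tensor_lift (\<lambda>(x, y). S x * y) (proj (\<Delta> h)) = PLbar (PL (S h))" for h
    by (rule proj_antipode_left)
qed simp_all

end

theorem mainTheorem6:
  fixes scale :: "'k::field \<Rightarrow> 'h::{ring,monoid_mult} \<Rightarrow> 'h"
    and \<Delta> :: "'h \<Rightarrow> ('h \<times> 'h) multiset set"
    and \<epsilon> :: "'h \<Rightarrow> 'k"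
    and S :: "'h \<Rightarrow> 'h"
  defines "A \<equiv> range (Pi_L scale \<Delta> \<epsilon>)"
    and "\<alpha> \<equiv> (\<lambda>a. a)"
    and "\<beta> \<equiv> Pi_L_bar scale \<Delta> \<epsilon>"
    and "B \<equiv> {k_tensor_times scale (k_tensor_times scale (\<Delta> 1) X) (\<Delta> 1) | X.
      X \<in> tensor_space (k_tensor_eq scale)}"
  assumes "weak_hopf_algebra scale \<Delta> \<epsilon> S"
    and "bij S"
  shows "balanced_hopf_algebroid scale A scale \<alpha> \<beta>
    (\<lambda>h. tensor_proj A \<alpha> \<beta> (\<Delta> h)) (Pi_L scale \<Delta> \<epsilon>) B S"
proof -
  interpret bijective_weak_hopf_algebra scale \<Delta> \<epsilon> S
    using assms(5,6) by (simp add: bijective_weak_hopf_algebra_def bijective_weak_hopf_algebra_axioms_def)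
  show ?thesis
    unfolding A_def \<alpha>_def \<beta>_def B_def by (rule hopf_algebroid)
qed

end
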